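(* Let $\Theta\subset\mathbb{R}^p$ be compact and convex, $\theta_0$ an interior point of $\Theta$, and let $\Theta\to M(T)$, $\theta\mapsto\mu_\theta$, be continuous and belong to $C^2(\Theta;M(T))$. Suppose that for $\theta\in\Theta$, $\mathcal{K}\mu_\theta(t)=\mathcal{K}\mu_{\theta_0}(t)$ for all $t\in T$ implies $\theta=\theta_0$, and that the $p\times p$ matrix $\Sigma$ with entries $\Sigma_{ij}=\langle\partial_i\mu_{\theta_0},\mathcal{K}\partial_j\mu_{\theta_0}\rangle$ is regular (invertible). Consider a joint limit $\varepsilon\to0$, $n\to\infty$ (i.e. any sequence of pairs $(\varepsilon,n)$ with $\varepsilon\to0$ and $n\to\infty$) along which $\varepsilon^{-1}\|K^n-K\|_{L^\infty}\to0$. Let $\hat\theta_{n,\varepsilon}\in\Theta$ be a maximizer over $\Theta$ of the contrast function $\Phi_{n,\varepsilon}$. Then, in this limit, $$\varepsilon^{-1}(\hat\theta_{n,\varepsilon}-\theta_0)\to\Sigma^{-1}\langle\nabla_\theta\mu_{\theta_0},Z\rangle\quad\text{in probability}.$$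
   Context: $T=[0,\tau]$ is a closed bounded interval; $C(T)$ is the Banach space of continuous real functions on $T$ with the sup norm; $M(T)=C(T)^*$ is the space of finite signed Borel measures on $T$ with the total variation norm; $\langle\mu,x\rangle=\int_T x_t\,\mu(dt)$. $Z$ is a centered Gaussian vector on $C(T)$, i.e. a $C(T)$-valued random vector on a probability space $(\Omega,\mathbb{P})$ such that $\langle\mu,Z\rangle$ is a centered normal variable for every $\mu\in M(T)$. Its covariance function $K(s,t)=\mathrm{Cov}[Z_s,Z_t]$ is continuous on $T^2$ and its covariance operator $\mathcal{K}:M(T)\to C(T)$ is $(\mathcal{K}\mu)(s)=\int_T K(s,t)\,\mu(dt)$. For each $n\in\mathbb{N}$ let $0=t_0<t_1<\dots<t_n=\tau$ (points depending on $n$) with $\lim_{n\to\infty}\sup_{i}|t_i-t_{i-1}|=0$, and $T_1=[0,t_1]$, $T_i=(t_{i-1},t_i]$ for $i\ge2$. $K^n=\sum_{i,j=1}^nK(t_i,t_j)\mathbf{1}_{T_i\times T_j}$, and $\|\cdot\|_{L^\infty}$ is the norm of $L^\infty(T^2)$. With $h_0=\mathcal{K}\mu_{\theta_0}$ and $X^\varepsilon=h_0+\varepsilon Z$ ($\varepsilon>0$), $$\Phi_{n,\varepsilon}(\theta)=\sum_{i=1}^n\mu_\theta(T_i)X^\varepsilon_{t_i}-\frac12\sum_{i,j=1}^n\mu_\theta(T_i)\mu_\theta(T_j)K(t_i,t_j).$$ $C^k(\Theta;M(T))$ is the set of maps $\theta\mapsto\mu_\theta$ from $\Theta$ to $M(T)$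 that are $k$ times Fréchet differentiable (total variation norm on $M(T)$) with uniformly continuous partial derivatives of order $k$; that is, differentiable in the interior of $\Theta$, with partial derivatives of order at most $k$ extending continuously to $\Theta$. $\partial_i=\partial/\partial\theta_i$, and $\langle\nabla_\theta\mu_{\theta_0},Z\rangle=(\langle\partial_1\mu_{\theta_0},Z\rangle,\dots,\langle\partial_p\mu_{\theta_0},Z\rangle)^{\mathsf T}$. *)

theory Defs
  imports "HOL-Analysis.Analysis" "HOL-Probability.Probability"
begin

section \<open>Finite signed Borel measures with the total variation norm\<close>

definition signed_borel_measure :: "('a::topological_space set \<Rightarrow> real) \<Rightarrow> bool" where
  "signed_borel_measure \<mu> \<longleftrightarrow>
     (\<forall>A::nat \<Rightarrow> 'a set. range A \<subseteq> sets borel \<longrightarrow> disjoint_family A \<longrightarrow>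
        (\<lambda>i. \<mu> (A i)) sums \<mu> (\<Union>i. A i))"

text \<open>The value \<open>0\<close> outside the Borel sets only makes the representation unique.\<close>

typedef (overloaded) 'a signed_measure =
  "{\<mu> :: 'a::topological_space set \<Rightarrow> real.
      signed_borel_measure \<mu> \<and> (\<forall>A. A \<notin> sets borel \<longrightarrow> \<mu> A = 0)}"
  morphisms smeasure Abs_signed_measure
  by (rule exI[of _ "\<lambda>_. 0"]) (auto simp: signed_borel_measure_def)

setup_lifting type_definition_signed_measure

lemma smeasure_sums:
  "range A \<subseteq> sets borel \<Longrightarrow> disjoint_family A \<Longrightarrow>
     (\<lambda>i::nat. smeasure \<mu> (A i)) sums smeasure \<mu> (\<Union>i. A i)"
  using smeasure[of \<mu>] by (auto simp: signed_borel_measure_def)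

lemma smeasure_notin: "A \<notin> sets borel \<Longrightarrow> smeasure \<mu> A = 0"
  using smeasure[of \<mu>] by auto

lemma signed_measure_eqI:
  "(\<And>A. A \<in> sets borel \<Longrightarrow> smeasure \<mu> A = smeasure \<nu> A) \<Longrightarrow> \<mu> = \<nu>"
  by (metis smeasure_inject smeasure_notin ext)

lemma smeasure_empty [simp]: "smeasure \<mu> {} = 0"
proof -
  have "(\<lambda>i::nat. smeasure \<mu> {}) sums smeasure \<mu> {}"
    using smeasure_sums[of "\<lambda>_. {}" \<mu>] by (simp add: disjoint_family_on_def)
  then have "(\<lambda>i::nat. smeasure \<mu> {}) \<longlonglongrightarrow> 0"
    by (simp add: sums_summable summable_LIMSEQ_zero)
  then show ?thesis
    by (simp add: LIMSEQ_const_iff)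
qed

lemma smeasure_Un:
  assumes "A \<in> sets borel" "B \<in> sets borel" "A \<inter> B = {}"
  shows "smeasure \<mu> (A \<union> B) = smeasure \<mu> A + smeasure \<mu> B"
proof -
  have "(\<lambda>i. smeasure \<mu> (binaryset A B i)) sums smeasure \<mu> (\<Union>i. binaryset A B i)"
    using assms by (intro smeasure_sums) (auto simp: range_binaryset_eq disjoint_family_on_def binaryset_def)
  moreover have "(\<lambda>i. smeasure \<mu> (binaryset A B i)) sums (smeasure \<mu> A + smeasure \<mu> B)"
    by (rule binaryset_sums) simp
  ultimately show ?thesis
    by (simp add: UN_binaryset_eq sums_unique2)
qed

lemma smeasure_diff:
  assumes "A \<in> sets borel" "B \<in> sets borel"
  shows "smeasure \<mu> A = smeasure \<mu> (A \<inter> B) + smeasure \<mu> (A - B)"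
proof -
  have "A = (A \<inter> B) \<union> (A - B)" by blast
  with smeasure_Un[of "A \<inter> B" "A - B" \<mu>] assms show ?thesis
    by (metis Diff_disjoint Int_Diff_disjoint sets.Diff sets.Int)
qed

lemma smeasure_Union:
  assumes "finite P" "P \<subseteq> sets borel" "disjoint P"
  shows "smeasure \<mu> (\<Union>P) = (\<Sum>B\<in>P. smeasure \<mu> B)"
  using assms
proof (induction P rule: finite_induct)
  case (insert B P)
  have "B \<inter> \<Union>P = {}"
    using insert.prems insert.hyps by (auto simp: disjoint_def)
  moreover have "\<Union>P \<in> sets borel"
    using insert by (auto intro!: sets.finite_Union)
  moreover have "disjoint P"
    using insert.prems by (auto simp: disjoint_def)
  ultimately show ?case
    using insert smeasure_Un[of B "\<Union>P" \<mu>] by simp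
qed simp

definition borel_partitions :: "'a::topological_space set \<Rightarrow> 'a set set set" where
  "borel_partitions A = {P. finite P \<and> P \<subseteq> sets borel \<and> partition_on A P}"

definition variation_sums :: "'a::topological_space signed_measure \<Rightarrow> 'a set \<Rightarrow> real set" where
  "variation_sums \<mu> A = (\<lambda>P. \<Sum>B\<in>P. \<bar>smeasure \<mu> B\<bar>) ` borel_partitions A"

definition variation :: "'a::topological_space signed_measure \<Rightarrow> 'a set \<Rightarrow> real" where
  "variation \<mu> A = Sup (variation_sums \<mu> A)"

lemma variation_sums_mem: "P \<in> borel_partitions A \<Longrightarrow> (\<Sum>B\<in>P. \<bar>smeasure \<mu> B\<bar>) \<in> variation_sums \<mu> A"
  by (auto simp: variation_sums_def)

lemma smeasure_mem_variation_sums: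
  assumes "A \<in> sets borel"
  shows "\<bar>smeasure \<mu> A\<bar> \<in> variation_sums \<mu> A"
proof (cases "A = {}")
  case True
  have "{} \<in> borel_partitions {}"
    by (auto simp: borel_partitions_def partition_on_def)
  from variation_sums_mem[OF this, of \<mu>] True show ?thesis by simp
next
  case False
  then have "{A} \<in> borel_partitions A"
    using assms by (auto simp: borel_partitions_def partition_on_space)
  from variation_sums_mem[OF this, of \<mu>] show ?thesis by simp
qed

lemma variation_sums_nonempty: "A \<in> sets borel \<Longrightarrow> variation_sums \<mu> A \<noteq> {}"
  using smeasure_mem_variation_sums by blast

lemma borel_partitions_restrict:
  assumes "P \<in> borel_partitions A" "B \<subseteq> A" "B \<in> sets borel"
  shows "(\<inter>) B ` P - {{}} \<in> borel_partitions B"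
    "(\<Sum>C\<in>(\<inter>) B ` P - {{}}. \<bar>smeasure \<mu> C\<bar>) = (\<Sum>C\<in>P. \<bar>smeasure \<mu> (B \<inter> C)\<bar>)"
proof -
  have P: "finite P" "P \<subseteq> sets borel" "partition_on A P"
    using assms by (auto simp: borel_partitions_def)
  have "B \<inter> A = B" using assms by auto
  with partition_on_restrict[OF P(3), of B]
  show "(\<inter>) B ` P - {{}} \<in> borel_partitions B"
    using P assms by (auto simp: borel_partitions_def)
  have "(\<Sum>C\<in>(\<inter>) B ` P - {{}}. \<bar>smeasure \<mu> C\<bar>) = (\<Sum>C\<in>(\<inter>) B ` P. \<bar>smeasure \<mu> C\<bar>)"
    using P by (intro sum.mono_neutral_left) auto
  also have "\<dots> = sum ((\<lambda>C. \<bar>smeasure \<mu> C\<bar>) \<circ> (\<inter>) B) P"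
  proof (rule sum.reindex_nontrivial[OF P(1)])
    fix C D assume "C \<in> P" "D \<in> P" "C \<noteq> D" "B \<inter> C = B \<inter> D"
    moreover from this P(3) have "C \<inter> D = {}"
      by (auto simp: partition_on_def disjoint_def)
    ultimately have "B \<inter> C = {}" by blast
    then show "\<bar>smeasure \<mu> (B \<inter> C)\<bar> = 0" by simp
  qed
  finally show "(\<Sum>C\<in>(\<inter>) B ` P - {{}}. \<bar>smeasure \<mu> C\<bar>) = (\<Sum>C\<in>P. \<bar>smeasure \<mu> (B \<inter> C)\<bar>)"
    by (simp add: comp_def)
qed

lemma borel_partitions_Un:
  assumes "P \<in> borel_partitions A" "Q \<in> borel_partitions B" "A \<inter> B = {}"
  shows "P \<union> Q \<in> borel_partitions (A \<union> B)"
    "(\<Sum>C\<in>P \<union> Q. \<bar>smeasure \<mu> C\<bar>) = (\<Sum>C\<in>P. \<bar>smeasure \<mu> C\<bar>) + (\<Sum>C\<in>Q. \<bar>smeasure \<mu> C\<bar>)"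
proof -
  have *: "C \<inter> D = {}" if "C \<in> P" "D \<in> Q" for C D
    using that assms by (auto simp: borel_partitions_def partition_on_def)
  moreover have "disjoint P" "disjoint Q"
    using assms by (auto simp: borel_partitions_def partition_on_def)
  ultimately have "disjoint (P \<union> Q)"
    unfolding disjoint_def by (metis Un_iff Int_commute)
  then show "P \<union> Q \<in> borel_partitions (A \<union> B)"
    using assms by (auto simp: borel_partitions_def partition_on_def)
  have "{} \<notin> P" using assms by (auto simp: borel_partitions_def partition_on_def)
  with * have "P \<inter> Q = {}" by (metis Int_absorb disjoint_iff)
  then show "(\<Sum>C\<in>P \<union> Q. \<bar>smeasure \<mu> C\<bar>) = (\<Sum>C\<in>P. \<bar>smeasure \<mu> C\<bar>) + (\<Sum>C\<in>Q. \<bar>smeasure \<mu> C\<bar>)"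
    using assms by (intro sum.union_disjoint) (auto simp: borel_partitions_def)
qed

lemma sum_split_le:
  assumes "P \<in> borel_partitions A" "B \<in> sets borel"
  shows "(\<Sum>C\<in>P. \<bar>smeasure \<mu> C\<bar>)
    \<le> (\<Sum>C\<in>P. \<bar>smeasure \<mu> (B \<inter> C)\<bar>) + (\<Sum>C\<in>P. \<bar>smeasure \<mu> (C - B)\<bar>)"
proof -
  have "\<bar>smeasure \<mu> C\<bar> \<le> \<bar>smeasure \<mu> (B \<inter> C)\<bar> + \<bar>smeasure \<mu> (C - B)\<bar>" if "C \<in> P" for C
    using smeasure_diff[of C B \<mu>] that assms by (auto simp: borel_partitions_def Int_commute)
  then show ?thesis
    unfolding sum.distrib[symmetric] by (rule sum_mono)
qed

lemma bdd_split:
  assumes B: "B \<in> sets borel" "B \<subseteq> A" and A: "A \<in> sets borel"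
    and 1: "bdd_above (variation_sums \<mu> B)" and 2: "bdd_above (variation_sums \<mu> (A - B))"
  shows "bdd_above (variation_sums \<mu> A)" (is ?thesis1)
    and "variation \<mu> A \<le> variation \<mu> B + variation \<mu> (A - B)" (is ?thesis2)
proof -
  have AB: "A - B \<in> sets borel" using A B by auto
  have *: "(\<Sum>C\<in>P. \<bar>smeasure \<mu> C\<bar>) \<le> variation \<mu> B + variation \<mu> (A - B)"
    if P: "P \<in> borel_partitions A" for P
  proof -
    have "(\<Sum>C\<in>P. \<bar>smeasure \<mu> (B \<inter> C)\<bar>) \<le> variation \<mu> B"
      unfolding borel_partitions_restrict(2)[OF P B(2,1), symmetric] variation_def
      by (intro cSup_upper 1 variation_sums_mem borel_partitions_restrict(1)[OF P B(2,1)])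
    moreover have "(\<Sum>C\<in>P. \<bar>smeasure \<mu> ((A - B) \<inter> C)\<bar>) \<le> variation \<mu> (A - B)"
      unfolding borel_partitions_restrict(2)[OF P Diff_subset AB, symmetric] variation_def
      by (intro cSup_upper 2 variation_sums_mem borel_partitions_restrict(1)[OF P Diff_subset AB])
    moreover have "(A - B) \<inter> C = C - B" if "C \<in> P" for C
      using P that by (auto simp: borel_partitions_def partition_on_def)
    ultimately show ?thesis
      using sum_split_le[OF P B(1), of \<mu>] by simp
  qed
  from * show ?thesis1 by (auto simp: variation_sums_def bdd_above_def)
  from * show ?thesis2
    unfolding variation_def[of \<mu> A]
    by (intro cSup_least variation_sums_nonempty A) (auto simp: variation_sums_def)
qed

lemma unbounded_step:
  assumes A: "A \<in> sets borel" and nb: "\<not> bdd_above (variation_sums \<mu> A)"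
  shows "\<exists>B\<in>sets borel. B \<subseteq> A \<and> 1 < \<bar>smeasure \<mu> (A - B)\<bar> \<and> \<not> bdd_above (variation_sums \<mu> B)"
proof -
  obtain P where P: "P \<in> borel_partitions A"
    and big: "2 * (1 + \<bar>smeasure \<mu> A\<bar>) < (\<Sum>C\<in>P. \<bar>smeasure \<mu> C\<bar>)"
    using nb by (auto simp: variation_sums_def bdd_above_def not_le)
  have fP: "finite P" "P \<subseteq> sets borel" "disjoint P" "\<Union>P = A"
    using P by (auto simp: borel_partitions_def partition_on_def)
  define Pp where "Pp = {C\<in>P. 0 \<le> smeasure \<mu> C}"
  define Pn where "Pn = {C\<in>P. smeasure \<mu> C < 0}"
  have "P = Pp \<union> Pn" "Pp \<inter> Pn = {}" "finite Pp" "finite Pn"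
    using fP by (auto simp: Pp_def Pn_def)
  then have "(\<Sum>C\<in>P. \<bar>smeasure \<mu> C\<bar>) = (\<Sum>C\<in>Pp. \<bar>smeasure \<mu> C\<bar>) + (\<Sum>C\<in>Pn. \<bar>smeasure \<mu> C\<bar>)"
    by (simp add: sum.union_disjoint)
  also have "(\<Sum>C\<in>Pp. \<bar>smeasure \<mu> C\<bar>) = (\<Sum>C\<in>Pp. smeasure \<mu> C)"
    by (intro sum.cong) (auto simp: Pp_def)
  also have "\<dots> = smeasure \<mu> (\<Union>Pp)"
    using fP by (intro smeasure_Union[symmetric]) (auto simp: Pp_def disjoint_def)
  also have "(\<Sum>C\<in>Pn. \<bar>smeasure \<mu> C\<bar>) = - (\<Sum>C\<in>Pn. smeasure \<mu> C)"
    unfolding sum_negf[symmetric] by (intro sum.cong) (auto simp: Pn_def)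
  also have "(\<Sum>C\<in>Pn. smeasure \<mu> C) = smeasure \<mu> (\<Union>Pn)"
    using fP by (intro smeasure_Union[symmetric]) (auto simp: Pn_def disjoint_def)
  finally have "1 + \<bar>smeasure \<mu> A\<bar> < \<bar>smeasure \<mu> (\<Union>Pp)\<bar> \<or> 1 + \<bar>smeasure \<mu> A\<bar> < \<bar>smeasure \<mu> (\<Union>Pn)\<bar>"
    using big by (smt (verit))
  moreover have "\<Union>Pp \<in> sets borel" "\<Union>Pn \<in> sets borel" "\<Union>Pp \<subseteq> A" "\<Union>Pn \<subseteq> A"
    using fP by (auto simp: Pp_def Pn_def intro!: sets.finite_Union)
  ultimately obtain B where B: "B \<in> sets borel" "B \<subseteq> A" "1 + \<bar>smeasure \<mu> A\<bar> < \<bar>smeasure \<mu> B\<bar>"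
    by blast
  have AB: "A - B \<in> sets borel" "A - (A - B) = B"
    using A B by auto
  have "smeasure \<mu> A = smeasure \<mu> B + smeasure \<mu> (A - B)"
    using smeasure_diff[OF A B(1), of \<mu>] B(2) by (simp add: Int_absorb1)
  with B have 1: "1 < \<bar>smeasure \<mu> B\<bar>" "1 < \<bar>smeasure \<mu> (A - B)\<bar>"
    by linarith+
  show ?thesis
  proof (cases "bdd_above (variation_sums \<mu> B)")
    case True
    then have "\<not> bdd_above (variation_sums \<mu> (A - B))"
      using bdd_split(1)[OF B(1,2) A, of \<mu>] nb by blast
    with AB 1 show ?thesis by (intro bexI[of _ "A - B"]) auto
  next
    case False
    with B 1 show ?thesis by (intro bexI[of _ B]) auto
  qed
qed

theorem finite_variation:
  assumes A: "A \<in> sets borel"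
  shows "bdd_above (variation_sums \<mu> A)"
proof (rule ccontr)
  assume nb: "\<not> bdd_above (variation_sums \<mu> A)"
  define Q where "Q B \<longleftrightarrow> B \<in> sets borel \<and> \<not> bdd_above (variation_sums \<mu> B)" for B
  have "\<exists>f. \<forall>n. Q (f n) \<and> (f (Suc n) \<subseteq> f n \<and> 1 < \<bar>smeasure \<mu> (f n - f (Suc n))\<bar>)"
  proof (rule dependent_nat_choice)
    show "\<exists>B. Q B" using A nb by (auto simp: Q_def)
    show "\<exists>C. Q C \<and> C \<subseteq> B \<and> 1 < \<bar>smeasure \<mu> (B - C)\<bar>" if "Q B" for B
      proof -
      from that obtain C where "C \<in> sets borel" "C \<subseteq> B" "1 < \<bar>smeasure \<mu> (B - C)\<bar>"
        "\<not> bdd_above (variation_sums \<mu> C)"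
        using unbounded_step[of B \<mu>] by (auto simp: Q_def)
      then show ?thesis by (auto simp: Q_def)
    qed
  qed
  then obtain f :: "nat \<Rightarrow> 'a set" where f: "\<And>n. Q (f n)"
    "\<And>n. f (Suc n) \<subseteq> f n" "\<And>n. 1 < \<bar>smeasure \<mu> (f n - f (Suc n))\<bar>"
    by blast
  have dec: "f n \<subseteq> f m" if "m \<le> n" for m n
    using lift_Suc_antimono_le[of f, OF f(2) that] .
  have "disjoint_family (\<lambda>n. f n - f (Suc n))"
    unfolding disjoint_family_on_def
  proof (intro ballI impI)
    fix m n :: nat assume "m \<noteq> n"
    then consider "Suc m \<le> n" | "Suc n \<le> m" by linarith
    then show "(f m - f (Suc m)) \<inter> (f n - f (Suc n)) = {}"
      by cases (use dec in blast)+
  qed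
  then have "(\<lambda>n. smeasure \<mu> (f n - f (Suc n))) sums smeasure \<mu> (\<Union>n. f n - f (Suc n))"
    using f(1) by (intro smeasure_sums) (auto simp: Q_def)
  then have "(\<lambda>n. \<bar>smeasure \<mu> (f n - f (Suc n))\<bar>) \<longlonglongrightarrow> 0"
    by (simp add: sums_summable summable_LIMSEQ_zero tendsto_rabs_zero)
  then have "\<forall>\<^sub>F n in sequentially. \<bar>smeasure \<mu> (f n - f (Suc n))\<bar> < 1"
    by (rule order_tendstoD) simp
  with f(3) show False
    by (metis (no_types, lifting) eventually_sequentially le_refl not_less_iff_gr_or_eq)
qed

lemma sum_le_variation:
  "A \<in> sets borel \<Longrightarrow> P \<in> borel_partitions A \<Longrightarrow> (\<Sum>B\<in>P. \<bar>smeasure \<mu> B\<bar>) \<le> variation \<mu> A"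
  unfolding variation_def by (intro cSup_upper finite_variation variation_sums_mem)

lemma abs_smeasure_le_variation: "A \<in> sets borel \<Longrightarrow> \<bar>smeasure \<mu> A\<bar> \<le> variation \<mu> A"
  unfolding variation_def by (intro cSup_upper finite_variation smeasure_mem_variation_sums)

lemma variation_nonneg: "A \<in> sets borel \<Longrightarrow> 0 \<le> variation \<mu> A"
  using abs_smeasure_le_variation[of A \<mu>] by linarith

lemma variation_leI:
  assumes "A \<in> sets borel" "\<And>P. P \<in> borel_partitions A \<Longrightarrow> (\<Sum>B\<in>P. \<bar>smeasure \<mu> B\<bar>) \<le> c"
  shows "variation \<mu> A \<le> c"
  unfolding variation_def using assms
  by (intro cSup_least variation_sums_nonempty) (auto simp: variation_sums_def)

lemma variation_Un:
  assumes "A \<in> sets borel" "B \<in> sets borel" "A \<inter> B = {}"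
  shows "variation \<mu> (A \<union> B) = variation \<mu> A + variation \<mu> B"
proof (rule antisym)
  have "A \<union> B - A = B" using assms by blast
  then show "variation \<mu> (A \<union> B) \<le> variation \<mu> A + variation \<mu> B"
    using bdd_split(2)[of A "A \<union> B" \<mu>] assms finite_variation[of _ \<mu>] by simp
  have "variation \<mu> A \<le> variation \<mu> (A \<union> B) - variation \<mu> B"
  proof (rule variation_leI[OF assms(1)])
    fix P assume P: "P \<in> borel_partitions A"
    have "variation \<mu> B \<le> variation \<mu> (A \<union> B) - (\<Sum>C\<in>P. \<bar>smeasure \<mu> C\<bar>)"
    proof (rule variation_leI[OF assms(2)])
      fix Q assume "Q \<in> borel_partitions B"
      from borel_partitions_Un[OF P this assms(3)]
      show "(\<Sum>C\<in>Q. \<bar>smeasure \<mu> C\<bar>) \<le> variation \<mu> (A \<union> B) - (\<Sum>C\<in>P. \<bar>smeasure \<mu> C\<bar>)"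
        using sum_le_variation[of "A \<union> B" "P \<union> Q" \<mu>] assms by auto
    qed
    then show "(\<Sum>C\<in>P. \<bar>smeasure \<mu> C\<bar>) \<le> variation \<mu> (A \<union> B) - variation \<mu> B"
      by simp
  qed
  then show "variation \<mu> A + variation \<mu> B \<le> variation \<mu> (A \<union> B)" by simp
qed

lemma variation_mono:
  assumes "A \<in> sets borel" "B \<in> sets borel" "A \<subseteq> B"
  shows "variation \<mu> A \<le> variation \<mu> B"
proof -
  have "A \<union> (B - A) = B" using assms by blast
  then show ?thesis
    using variation_Un[of A "B - A" \<mu>] variation_nonneg[of "B - A" \<mu>] assms by auto
qed

lemma variation_empty [simp]: "variation \<mu> {} = 0"
  using variation_Un[of "{}" "{}" \<mu>] by simp

lemma variation_UN_lessThan: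
  assumes "range A \<subseteq> sets borel" "disjoint_family A"
  shows "variation \<mu> (\<Union>i<n::nat. A i) = (\<Sum>i<n. variation \<mu> (A i))"
proof (induction n)
  case (Suc n)
  have "(\<Union>i<n. A i) \<inter> A n = {}"
    proof -
    have "A i \<inter> A n = {}" if "i < n" for i
      using disjoint_family_onD[OF assms(2), of i n] that by simp
    then show ?thesis by blast
  qed
  moreover have "(\<Union>i<n. A i) \<in> sets borel" "A n \<in> sets borel"
    using assms(1) by auto
  ultimately have "variation \<mu> ((\<Union>i<n. A i) \<union> A n) = variation \<mu> (\<Union>i<n. A i) + variation \<mu> (A n)"
    by (intro variation_Un)
  then show ?case
    by (simp add: Suc lessThan_Suc Un_commute)
qed simp

theorem variation_sums_UN:
  fixes A :: "nat \<Rightarrow> 'a::topological_space set"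
  assumes A: "range A \<subseteq> sets borel" "disjoint_family A"
  shows "(\<lambda>i. variation \<mu> (A i)) sums variation \<mu> (\<Union>i. A i)"
proof -
  let ?U = "\<Union>i. A i"
  have Ai: "A i \<in> sets borel" for i using A by auto
  have U: "?U \<in> sets borel" using Ai by blast
  have fin: "(\<Sum>i<n. variation \<mu> (A i)) \<le> variation \<mu> ?U" for n
  proof -
    have "(\<Union>i<n. A i) \<in> sets borel" using Ai by blast
    then show ?thesis
      using variation_mono[of "\<Union>i<n. A i" ?U \<mu>] U by (auto simp: variation_UN_lessThan[OF A])
  qed
  have summ: "summable (\<lambda>i. variation \<mu> (A i))"
    by (rule summableI_nonneg_bounded[of _ "variation \<mu> ?U"])
      (use fin variation_nonneg[OF Ai] in auto)
  have "variation \<mu> ?U \<le> (\<Sum>i. variation \<mu> (A i))"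
  proof (rule variation_leI[OF U])
    fix P assume P: "P \<in> borel_partitions ?U"
    have fP: "finite P" "P \<subseteq> sets borel" "\<Union>P = ?U"
      using P by (auto simp: borel_partitions_def partition_on_def)
    have le: "(\<Sum>C\<in>P. \<bar>smeasure \<mu> (A i \<inter> C)\<bar>) \<le> variation \<mu> (A i)" for i
      unfolding borel_partitions_restrict(2)[OF P UN_upper[OF UNIV_I] Ai, symmetric]
      by (intro sum_le_variation Ai borel_partitions_restrict(1)[OF P UN_upper[OF UNIV_I] Ai])
    have sc: "summable (\<lambda>i. \<bar>smeasure \<mu> (A i \<inter> C)\<bar>)" if C: "C \<in> P" for C
    proof (rule summable_comparison_test'[OF summ, of 0])
      fix i :: nat
      have "\<bar>smeasure \<mu> (A i \<inter> C)\<bar> \<le> (\<Sum>C\<in>P. \<bar>smeasure \<mu> (A i \<inter> C)\<bar>)"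
        using C fP(1) by (intro member_le_sum) auto
      with le[of i] show "norm \<bar>smeasure \<mu> (A i \<inter> C)\<bar> \<le> variation \<mu> (A i)" by simp
    qed
    have "(\<Sum>C\<in>P. \<bar>smeasure \<mu> C\<bar>) \<le> (\<Sum>C\<in>P. \<Sum>i. \<bar>smeasure \<mu> (A i \<inter> C)\<bar>)"
    proof (rule sum_mono)
      fix C assume C: "C \<in> P"
      have eq: "(\<Union>i. A i \<inter> C) = C" using C fP by blast
      have "(\<lambda>i. smeasure \<mu> (A i \<inter> C)) sums smeasure \<mu> (\<Union>i. A i \<inter> C)"
        using A C fP(2) by (intro smeasure_sums) (auto simp: disjoint_family_on_def)
      then have "smeasure \<mu> C = (\<Sum>i. smeasure \<mu> (A i \<inter> C))"
        unfolding eq by (rule sums_unique)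
      with summable_rabs[OF sc[OF C]]
      show "\<bar>smeasure \<mu> C\<bar> \<le> (\<Sum>i. \<bar>smeasure \<mu> (A i \<inter> C)\<bar>)" by simp
    qed
    also have "\<dots> = (\<Sum>i. \<Sum>C\<in>P. \<bar>smeasure \<mu> (A i \<inter> C)\<bar>)"
      by (rule suminf_sum[symmetric]) (rule sc)
    also have "\<dots> \<le> (\<Sum>i. variation \<mu> (A i))"
      by (rule suminf_le) (auto intro: le summable_sum sc summ)
    finally show "(\<Sum>C\<in>P. \<bar>smeasure \<mu> C\<bar>) \<le> (\<Sum>i. variation \<mu> (A i))" .
  qed
  moreover have "(\<Sum>i. variation \<mu> (A i)) \<le> variation \<mu> ?U"
    by (rule suminf_le_const[OF summ fin])
  ultimately show ?thesis
    using summ by (simp add: sums_iff)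
qed

instantiation signed_measure :: (topological_space) real_vector
begin

lift_definition zero_signed_measure :: "'a signed_measure" is "\<lambda>_. 0"
  by (auto simp: signed_borel_measure_def)

lift_definition plus_signed_measure :: "'a signed_measure \<Rightarrow> 'a signed_measure \<Rightarrow> 'a signed_measure"
  is "\<lambda>\<mu> \<nu> A. \<mu> A + \<nu> A"
  by (auto simp: signed_borel_measure_def intro!: sums_add)

lift_definition minus_signed_measure :: "'a signed_measure \<Rightarrow> 'a signed_measure \<Rightarrow> 'a signed_measure"
  is "\<lambda>\<mu> \<nu> A. \<mu> A - \<nu> A"
  by (auto simp: signed_borel_measure_def intro!: sums_diff)

lift_definition uminus_signed_measure :: "'a signed_measure \<Rightarrow> 'a signed_measure"
  is "\<lambda>\<mu> A. - \<mu> A"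
  by (auto simp: signed_borel_measure_def intro!: sums_minus)

lift_definition scaleR_signed_measure :: "real \<Rightarrow> 'a signed_measure \<Rightarrow> 'a signed_measure"
  is "\<lambda>c \<mu> A. c * \<mu> A"
  by (auto simp: signed_borel_measure_def intro!: sums_mult)

lemma smeasure_zero [simp]: "smeasure 0 A = 0"
  by transfer simp

lemma smeasure_add [simp]: "smeasure (\<mu> + \<nu>) A = smeasure \<mu> A + smeasure \<nu> A"
  by transfer simp

lemma smeasure_minus [simp]: "smeasure (\<mu> - \<nu>) A = smeasure \<mu> A - smeasure \<nu> A"
  by transfer simp

lemma smeasure_uminus [simp]: "smeasure (- \<mu>) A = - smeasure \<mu> A"
  by transfer simp

lemma smeasure_scaleR [simp]: "smeasure (c *\<^sub>R \<mu>) A = c * smeasure \<mu> A"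
  by transfer simp

instance
proof
  fix \<mu> \<nu> \<rho> :: "'a signed_measure" and a b :: real
  show "\<mu> + \<nu> + \<rho> = \<mu> + (\<nu> + \<rho>)"
    by (rule signed_measure_eqI) (simp add: algebra_simps)
  show "\<mu> + \<nu> = \<nu> + \<mu>"
    by (rule signed_measure_eqI) (simp add: algebra_simps)
  show "0 + \<mu> = \<mu>"
    by (rule signed_measure_eqI) (simp add: algebra_simps)
  show "- \<mu> + \<mu> = 0"
    by (rule signed_measure_eqI) (simp add: algebra_simps)
  show "\<mu> - \<nu> = \<mu> + - \<nu>"
    by (rule signed_measure_eqI) (simp add: algebra_simps)
  show "a *\<^sub>R (\<mu> + \<nu>) = a *\<^sub>R \<mu> + a *\<^sub>R \<nu>"
    by (rule signed_measure_eqI) (simp add: algebra_simps)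
  show "(a + b) *\<^sub>R \<mu> = a *\<^sub>R \<mu> + b *\<^sub>R \<mu>"
    by (rule signed_measure_eqI) (simp add: algebra_simps)
  show "a *\<^sub>R b *\<^sub>R \<mu> = (a * b) *\<^sub>R \<mu>"
    by (rule signed_measure_eqI) (simp add: algebra_simps)
  show "1 *\<^sub>R \<mu> = \<mu>"
    by (rule signed_measure_eqI) (simp add: algebra_simps)
qed

end

instantiation signed_measure :: (topological_space) real_normed_vector
begin

definition norm_signed_measure :: "'a signed_measure \<Rightarrow> real" where
  "norm_signed_measure \<mu> = variation \<mu> UNIV"

definition sgn_signed_measure :: "'a signed_measure \<Rightarrow> 'a signed_measure" where
  "sgn_signed_measure \<mu> = \<mu> /\<^sub>R norm \<mu>"

definition dist_signed_measure :: "'a signed_measure \<Rightarrow> 'a signed_measure \<Rightarrow> real" where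
  "dist_signed_measure \<mu> \<nu> = norm (\<mu> - \<nu>)"

definition uniformity_signed_measure :: "('a signed_measure \<times> 'a signed_measure) filter" where
  "uniformity_signed_measure = (INF e\<in>{0<..}. principal {(x, y). dist x y < e})"

definition open_signed_measure :: "'a signed_measure set \<Rightarrow> bool" where
  "open_signed_measure U \<longleftrightarrow> (\<forall>x\<in>U. \<forall>\<^sub>F (x', y) in uniformity. x' = x \<longrightarrow> y \<in> U)"

instance
proof
  fix \<mu> \<nu> :: "'a signed_measure" and a :: real and U :: "'a signed_measure set"
  show "dist \<mu> \<nu> = norm (\<mu> - \<nu>)" "sgn \<mu> = \<mu> /\<^sub>R norm \<mu>"
    "(uniformity :: ('a signed_measure \<times> _) filter) = (INF e\<in>{0<..}. principal {(x, y). dist x y < e})"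
    "open U \<longleftrightarrow> (\<forall>x\<in>U. \<forall>\<^sub>F (x', y) in uniformity. x' = x \<longrightarrow> y \<in> U)"
    by (simp_all add: dist_signed_measure_def sgn_signed_measure_def
        uniformity_signed_measure_def open_signed_measure_def)
  show "norm \<mu> = 0 \<longleftrightarrow> \<mu> = 0"
  proof
    assume "norm \<mu> = 0"
    then have "\<bar>smeasure \<mu> A\<bar> \<le> 0" if "A \<in> sets borel" for A
      using abs_smeasure_le_variation[OF that, of \<mu>] variation_mono[OF that, of UNIV \<mu>]
      by (simp add: norm_signed_measure_def)
    then show "\<mu> = 0"
      by (intro signed_measure_eqI) simp
  next
    assume "\<mu> = 0"
    then have "variation \<mu> UNIV \<le> 0"
      by (intro variation_leI) simp_all
    then show "norm \<mu> = 0"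
      using variation_nonneg[of UNIV \<mu>] by (simp add: norm_signed_measure_def)
  qed
  show "norm (\<mu> + \<nu>) \<le> norm \<mu> + norm \<nu>"
    unfolding norm_signed_measure_def
  proof (rule variation_leI)
    fix P :: "'a set set" assume P: "P \<in> borel_partitions UNIV"
    have "(\<Sum>B\<in>P. \<bar>smeasure (\<mu> + \<nu>) B\<bar>) \<le> (\<Sum>B\<in>P. \<bar>smeasure \<mu> B\<bar>) + (\<Sum>B\<in>P. \<bar>smeasure \<nu> B\<bar>)"
      unfolding sum.distrib[symmetric] smeasure_add by (intro sum_mono abs_triangle_ineq)
    also have "\<dots> \<le> variation \<mu> UNIV + variation \<nu> UNIV"
      using P by (intro add_mono sum_le_variation) auto
    finally show "(\<Sum>B\<in>P. \<bar>smeasure (\<mu> + \<nu>) B\<bar>) \<le> variation \<mu> UNIV + variation \<nu> UNIV" .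
  qed simp
  have le: "norm (a *\<^sub>R \<mu>) \<le> \<bar>a\<bar> * norm \<mu>" for a and \<mu> :: "'a signed_measure"
    unfolding norm_signed_measure_def
  proof (rule variation_leI)
    fix P :: "'a set set" assume P: "P \<in> borel_partitions UNIV"
    have "(\<Sum>B\<in>P. \<bar>smeasure (a *\<^sub>R \<mu>) B\<bar>) = \<bar>a\<bar> * (\<Sum>B\<in>P. \<bar>smeasure \<mu> B\<bar>)"
      by (simp add: abs_mult sum_distrib_left)
    also have "\<dots> \<le> \<bar>a\<bar> * variation \<mu> UNIV"
      using P by (intro mult_left_mono sum_le_variation) auto
    finally show "(\<Sum>B\<in>P. \<bar>smeasure (a *\<^sub>R \<mu>) B\<bar>) \<le> \<bar>a\<bar> * variation \<mu> UNIV" .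
  qed simp
  show "norm (a *\<^sub>R \<mu>) = \<bar>a\<bar> * norm \<mu>"
  proof (cases "a = 0")
    case True
    then show ?thesis
      using le[of a \<mu>] variation_nonneg[of UNIV "a *\<^sub>R \<mu>"] by (simp add: norm_signed_measure_def)
  next
    case False
    have "inverse a *\<^sub>R a *\<^sub>R \<mu> = \<mu>"
      by (rule signed_measure_eqI) (use False in simp)
    with le[of "inverse a" "a *\<^sub>R \<mu>"] have "norm \<mu> \<le> \<bar>inverse a\<bar> * norm (a *\<^sub>R \<mu>)"
      by simp
    with False have "\<bar>a\<bar> * norm \<mu> \<le> norm (a *\<^sub>R \<mu>)"
      by (simp add: field_simps abs_inverse)
    with le[of a \<mu>] show ?thesis by simp
  qed
qed

end

text \<open>Integration against a signed measure goes through its Jordan decomposition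
  \<open>\<mu> = \<mu>\<^sup>+ - \<mu>\<^sup>-\<close>, where \<open>\<mu>\<^sup>+ = (|\<mu>| + \<mu>) / 2\<close> and \<open>\<mu>\<^sup>- = (-\<mu>)\<^sup>+\<close>.\<close>

definition pos_part :: "'a::topological_space signed_measure \<Rightarrow> 'a measure" where
  "pos_part \<mu> = measure_of UNIV (sets borel) (\<lambda>A. ennreal ((variation \<mu> A + smeasure \<mu> A) / 2))"

definition neg_part :: "'a::topological_space signed_measure \<Rightarrow> 'a measure" where
  "neg_part \<mu> = pos_part (- \<mu>)"

lemma space_pos_part [simp]: "space (pos_part \<mu>) = UNIV"
  and sets_pos_part [simp, measurable_cong]: "sets (pos_part \<mu>) = sets borel"
  by (simp_all add: pos_part_def sets.sets_measure_of_eq[of borel, simplified])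

lemma emeasure_pos_part:
  assumes "A \<in> sets borel"
  shows "emeasure (pos_part \<mu>) A = ennreal ((variation \<mu> A + smeasure \<mu> A) / 2)"
proof (rule emeasure_measure_of[OF pos_part_def])
  show "countably_additive (sets (pos_part \<mu>)) (\<lambda>A. ennreal ((variation \<mu> A + smeasure \<mu> A) / 2))"
    unfolding countably_additive_def sets_pos_part
  proof (intro allI impI)
    fix A :: "nat \<Rightarrow> 'a set"
    assume A: "range A \<subseteq> sets borel" "disjoint_family A"
    have "(\<lambda>i. (variation \<mu> (A i) + smeasure \<mu> (A i)) / 2) sums
        ((variation \<mu> (\<Union>i. A i) + smeasure \<mu> (\<Union>i. A i)) / 2)"
      by (intro sums_divide sums_add variation_sums_UN smeasure_sums A)
    moreover have "0 \<le> (variation \<mu> (A i) + smeasure \<mu> (A i)) / 2" for i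
      using abs_smeasure_le_variation[of "A i" \<mu>] A(1) by auto
    ultimately show "(\<Sum>i. ennreal ((variation \<mu> (A i) + smeasure \<mu> (A i)) / 2)) =
        ennreal ((variation \<mu> (\<Union>i. A i) + smeasure \<mu> (\<Union>i. A i)) / 2)"
      by (intro suminf_ennreal_eq)
  qed
qed (use assms in \<open>auto simp: positive_def\<close>)

lemma variation_uminus [simp]: "variation (- \<mu>) A = variation \<mu> A"
  by (simp add: variation_def variation_sums_def)

lemma smeasure_Jordan:
  assumes "A \<in> sets borel"
  shows "smeasure \<mu> A = measure (pos_part \<mu>) A - measure (neg_part \<mu>) A"
    and "variation \<mu> A = measure (pos_part \<mu>) A + measure (neg_part \<mu>) A"
  using abs_smeasure_le_variation[OF assms, of \<mu>]
  by (simp_all add: measure_def neg_part_def emeasure_pos_part[OF assms] field_simps)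

text \<open>\<open>M(T)\<close>: the signed Borel measures concentrated on \<open>T\<close>.\<close>

definition signed_measures_on :: "'a::topological_space set \<Rightarrow> 'a signed_measure set" where
  "signed_measures_on T = {\<mu>. \<forall>A\<in>sets borel. A \<inter> T = {} \<longrightarrow> smeasure \<mu> A = 0}"

definition pairing :: "'a::topological_space set \<Rightarrow> 'a signed_measure \<Rightarrow> ('a \<Rightarrow> real) \<Rightarrow> real" where
  "pairing T \<mu> x = (LINT t:T|pos_part \<mu>. x t) - (LINT t:T|neg_part \<mu>. x t)"


section \<open>Differentiability up to the boundary\<close>

definition partial_deriv :: "(real^'p \<Rightarrow> 'b::real_normed_vector) \<Rightarrow> 'p \<Rightarrow> real^'p \<Rightarrow> 'b" where
  "partial_deriv f i x = frechet_derivative f (at x) (axis i 1)"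

definition extends_continuously :: "(real^'p) set \<Rightarrow> (real^'p \<Rightarrow> 'b::real_normed_vector) \<Rightarrow> bool" where
  "extends_continuously \<Theta> f \<longleftrightarrow> (\<exists>g. continuous_on \<Theta> g \<and> (\<forall>x\<in>interior \<Theta>. g x = f x))"

text \<open>Since \<open>D f(x) h = (\<Sum>i. h\<^sub>i \<partial>\<^sub>i f(x))\<close>, the Frechet derivative is \<open>k\<close> times
  Frechet differentiable exactly if all \<open>\<partial>\<^sub>i f\<close> are; this gives the recursion.\<close>

primrec C_diff :: "nat \<Rightarrow> (real^'p) set \<Rightarrow> (real^'p \<Rightarrow> 'b::real_normed_vector) \<Rightarrow> bool" where
  "C_diff 0 \<Theta> f \<longleftrightarrow> extends_continuously \<Theta> f"
| "C_diff (Suc k) \<Theta> f \<longleftrightarrow> extends_continuously \<Theta> f \<and>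
     (\<forall>x\<in>interior \<Theta>. f differentiable (at x)) \<and> (\<forall>i. C_diff k \<Theta> (partial_deriv f i))"


section \<open>Gaussian vectors in \<open>C(T)\<close>\<close>

text \<open>\<open>C(T)\<close> with the sup metric; its elements are extensional functions, that is,
  they take the value \<open>undefined\<close> outside \<open>T\<close>.\<close>

abbreviation C_space :: "real set \<Rightarrow> (real \<Rightarrow> real) metric" where
  "C_space T \<equiv> cfunspace (top_of_set T) euclidean_metric"

definition borel_C :: "real set \<Rightarrow> (real \<Rightarrow> real) measure" where
  "borel_C T = sigma (mspace (C_space T)) {U. openin (mtopology_of (C_space T)) U}"

text \<open>Variance \<open>0\<close> is allowed.\<close>

definition centered_normal :: "'w measure \<Rightarrow> ('w \<Rightarrow> real) \<Rightarrow> bool" where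
  "centered_normal P X \<longleftrightarrow> X \<in> borel_measurable P \<and>
     ((AE \<omega> in P. X \<omega> = 0) \<or>
      (\<exists>\<sigma>>0. distributed P lborel X (\<lambda>x. ennreal (normal_density 0 \<sigma> x))))"

definition centered_gaussian_vector :: "real set \<Rightarrow> 'w measure \<Rightarrow> ('w \<Rightarrow> real \<Rightarrow> real) \<Rightarrow> bool" where
  "centered_gaussian_vector T P Z \<longleftrightarrow> Z \<in> P \<rightarrow>\<^sub>M borel_C T \<and>
     (\<forall>\<mu>\<in>signed_measures_on T. centered_normal P (\<lambda>\<omega>. pairing T \<mu> (Z \<omega>)))"

definition covariance :: "'w measure \<Rightarrow> ('w \<Rightarrow> real) \<Rightarrow> ('w \<Rightarrow> real) \<Rightarrow> real" where
  "covariance P X Y =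
     (LINT \<omega>|P. (X \<omega> - (LINT \<omega>'|P. X \<omega>')) * (Y \<omega> - (LINT \<omega>'|P. Y \<omega>')))"

definition cov_fun :: "'w measure \<Rightarrow> ('w \<Rightarrow> real \<Rightarrow> real) \<Rightarrow> real \<Rightarrow> real \<Rightarrow> real" where
  "cov_fun P Z s t = covariance P (\<lambda>\<omega>. Z \<omega> s) (\<lambda>\<omega>. Z \<omega> t)"

definition cov_op :: "real set \<Rightarrow> (real \<Rightarrow> real \<Rightarrow> real) \<Rightarrow> real signed_measure \<Rightarrow> real \<Rightarrow> real" where
  "cov_op T K \<mu> s = pairing T \<mu> (\<lambda>t. K s t)"


section \<open>The discretized contrast function\<close>

definition grid :: "real \<Rightarrow> nat \<Rightarrow> (nat \<Rightarrow> real) \<Rightarrow> bool" where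
  "grid \<tau> n t \<longleftrightarrow> t 0 = 0 \<and> t n = \<tau> \<and> (\<forall>i\<in>{1..n}. t (i - 1) < t i)"

definition mesh :: "nat \<Rightarrow> (nat \<Rightarrow> real) \<Rightarrow> real" where
  "mesh n t = (SUP i\<in>{1..n}. \<bar>t i - t (i - 1)\<bar>)"

definition cell :: "(nat \<Rightarrow> real) \<Rightarrow> nat \<Rightarrow> real set" where
  "cell t i = (if i = 1 then {0..t 1} else {t (i - 1)<..t i})"

definition discrete_kernel ::
  "(real \<Rightarrow> real \<Rightarrow> real) \<Rightarrow> nat \<Rightarrow> (nat \<Rightarrow> real) \<Rightarrow> real \<times> real \<Rightarrow> real" where
  "discrete_kernel K n t p =
     (\<Sum>i=1..n. \<Sum>j=1..n. K (t i) (t j) * indicator (cell t i \<times> cell t j) p)"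

definition Linf_norm :: "(real \<times> real) set \<Rightarrow> (real \<times> real \<Rightarrow> real) \<Rightarrow> ereal" where
  "Linf_norm S f = esssup (restrict_space lborel S) (\<lambda>p. ereal \<bar>f p\<bar>)"

definition contrast ::
  "(real \<Rightarrow> real \<Rightarrow> real) \<Rightarrow> (real^'p \<Rightarrow> real signed_measure) \<Rightarrow> nat \<Rightarrow> (nat \<Rightarrow> real)
    \<Rightarrow> (real \<Rightarrow> real) \<Rightarrow> real^'p \<Rightarrow> real" where
  "contrast K \<mu> n t x \<theta> =
     (\<Sum>i=1..n. smeasure (\<mu> \<theta>) (cell t i) * x (t i))
     - 1/2 * (\<Sum>i=1..n. \<Sum>j=1..n. smeasure (\<mu> \<theta>) (cell t i) * smeasure (\<mu> \<theta>) (cell t j) * K (t i) (t j))"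

definition tendsto_in_probability ::
  "'w measure \<Rightarrow> (nat \<Rightarrow> 'w \<Rightarrow> 'b::metric_space) \<Rightarrow> ('w \<Rightarrow> 'b) \<Rightarrow> bool" where
  "tendsto_in_probability P X Y \<longleftrightarrow>
     (\<forall>\<delta>>0. (\<lambda>k. measure P {\<omega>\<in>space P. dist (X k \<omega>) (Y \<omega>) > \<delta>}) \<longlonglongrightarrow> 0)"

end

theory Submission
  imports Defs
begin

text \<open>
  The convergence holds for every \<open>\<omega>\<close>, not merely in probability: Gaussianity of \<open>Z\<close> enters only
  through the properties of the covariance function \<open>K\<close>, and the estimator is analysed path by path.

  Write \<open>B(\<nu>, \<rho>) = \<langle>\<nu>, K\<rho>\<rangle>\<close> on signed measures. The kernel \<open>K\<close> is positive semidefinite, and it is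
  continuous because \<open>K(s, u) = ln E cos(Z\<^sub>s - Z\<^sub>u) - ln E cos Z\<^sub>s - ln E cos Z\<^sub>u\<close>
  (\<open>cov_fun_log_char\<close>), where dominated convergence applies. Integrals of continuous functions against
  a signed measure are limits of the finite sums \<open>quadrature\<close>, with an error controlled by the
  oscillation on the cells and the total variation (\<open>quadrature_error\<close>). Passing to the limit,
  \<open>B\<close> is a bounded symmetric positive semidefinite form, and the Cauchy-Schwarz inequality against
  point masses shows that \<open>B(\<nu>, \<nu>) = 0\<close> forces \<open>K\<nu> = 0\<close> (\<open>cov_op_eq_0_if_energy_eq_0\<close>), which is
  what identifiability needs.

  The essential supremum of \<open>|K\<^sup>n - K|\<close> bounds this difference at every point
  (\<open>oscillation_le_if_Linf_norm_le\<close>). Hence, uniformly on bounded sets of signed measures, the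
  contrast differs from \<open>B(\<mu>\<^sub>\<theta>, \<mu>\<^sub>0) + \<epsilon> \<langle>\<mu>\<^sub>\<theta>, Z\<rangle> - B(\<mu>\<^sub>\<theta>, \<mu>\<^sub>\<theta>)/2\<close> by \<open>o(\<epsilon>)\<close>, where \<open>\<mu>\<^sub>0\<close> is the measure
  at \<open>\<theta>\<^sub>0\<close>. Since \<open>B(\<mu>\<^sub>\<theta>, \<mu>\<^sub>0) - B(\<mu>\<^sub>\<theta>, \<mu>\<^sub>\<theta>)/2\<close> equals a constant minus half of
  \<open>B(\<mu>\<^sub>\<theta> - \<mu>\<^sub>0, \<mu>\<^sub>\<theta> - \<mu>\<^sub>0)\<close>, compactness of \<open>\<Theta>\<close> yields consistency. The estimator is then eventually
  interior, so the first order condition holds,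
  \<open>B(\<partial>\<^sub>i\<mu>, \<mu> - \<mu>\<^sub>0) = \<epsilon> \<langle>\<partial>\<^sub>i\<mu>, Z\<rangle> + o(\<epsilon>)\<close> with \<open>\<mu>\<close> and \<open>\<partial>\<^sub>i\<mu>\<close> taken at the estimator. Differentiability of
  \<open>\<mu>\<close> at \<open>\<theta>\<^sub>0\<close> and continuity of the \<open>\<partial>\<^sub>i\<mu>\<close> turn it into
  \<open>\<Sigma> w = \<langle>\<nabla>\<mu>\<^sub>0, Z\<rangle> + o(1 + |w|)\<close> for the normalized deviation \<open>w\<close>, and inverting \<open>\<Sigma>\<close> gives the
  limit (\<open>maximizer_expansion\<close>, in an abstract normed space).
\<close>

section \<open>Grids\<close>

lemma grid_mono:
  assumes "grid \<tau> n t" "i \<le> j" "j \<le> n"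
  shows "t i \<le> t j"
  using assms(2,3)
proof (induction rule: dec_induct)
  case (step m)
  have "t (Suc m - 1) < t (Suc m)"
    using assms(1) step.prems unfolding grid_def by fastforce
  then show ?case using step by simp
qed simp

lemma grid_in_interval: "grid \<tau> n t \<Longrightarrow> i \<le> n \<Longrightarrow> t i \<in> {0..\<tau>}"
  using grid_mono[of \<tau> n t 0 i] grid_mono[of \<tau> n t i n] by (auto simp: grid_def)

lemma borel_cell [measurable, simp]: "cell t i \<in> sets borel"
  by (simp add: cell_def)

lemma UN_cell_upto:
  assumes "grid \<tau> n t" "1 \<le> m" "m \<le> n"
  shows "(\<Union>i\<in>{1..m}. cell t i) = {0..t m}"
  using assms(2,3)
proof (induction rule: dec_induct)
  case base
  then show ?case by (simp add: cell_def)
next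
  case (step m)
  have "0 \<le> t m" "t m \<le> t (Suc m)"
    using grid_in_interval[OF assms(1), of m] grid_mono[OF assms(1), of m "Suc m"] step by auto
  moreover have "(\<Union>i\<in>{1..Suc m}. cell t i) = {0..t m} \<union> {t m<..t (Suc m)}"
    using step by (auto simp: atLeastAtMostSuc_conv cell_def)
  ultimately show ?case by auto
qed

lemma UN_cell: "grid \<tau> n t \<Longrightarrow> n \<ge> 1 \<Longrightarrow> (\<Union>i\<in>{1..n}. cell t i) = {0..\<tau>}"
  using UN_cell_upto[of \<tau> n t n] by (simp add: grid_def)

lemma disjoint_cell:
  assumes g: "grid \<tau> n t"
  shows "disjoint_family_on (cell t) {1..n}"
proof -
  have less: "cell t i \<inter> cell t j = {}" if "1 \<le> i" "i < j" "j \<le> n" for i j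
  proof -
    have "t i \<le> t (j - 1)" using that by (intro grid_mono[OF g]) auto
    then show ?thesis using that by (auto simp: cell_def)
  qed
  show ?thesis
    unfolding disjoint_family_on_def
  proof (intro ballI impI)
    fix i j assume "i \<in> {1..n}" "j \<in> {1..n}" "i \<noteq> j"
    then show "cell t i \<inter> cell t j = {}"
      using less[of i j] less[of j i] by (cases "i < j") auto
  qed
qed

lemma cell_subset: "grid \<tau> n t \<Longrightarrow> i \<in> {1..n} \<Longrightarrow> cell t i \<subseteq> {0..\<tau>}"
  using UN_cell[of \<tau> n t] by fastforce

lemma node_in_cell: "grid \<tau> n t \<Longrightarrow> i \<in> {1..n} \<Longrightarrow> t i \<in> cell t i"
  using grid_in_interval[of \<tau> n t i] by (auto simp: grid_def cell_def)

lemma dist_node_le_mesh: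
  assumes g: "grid \<tau> n t" and i: "i \<in> {1..n}" and s: "s \<in> cell t i"
  shows "\<bar>t i - s\<bar> \<le> mesh n t"
proof -
  have "t 0 = 0" using g by (simp add: grid_def)
  then have "\<bar>t i - s\<bar> \<le> \<bar>t i - t (i - 1)\<bar>"
    using s by (auto simp: cell_def split: if_splits)
  also have "\<dots> \<le> mesh n t"
    unfolding mesh_def by (intro cSUP_upper i) auto
  finally show ?thesis .
qed

text \<open>The equidistant grid; it serves to write integrals as limits of finite sums wherever no
  particular grid is given. Its value for \<open>n = 0\<close> is irrelevant.\<close>

definition uniform_grid :: "real \<Rightarrow> nat \<Rightarrow> nat \<Rightarrow> real" where
  "uniform_grid \<tau> n i = \<tau> * real i / real n"

lemma grid_uniform_grid: "\<tau> > 0 \<Longrightarrow> n \<ge> 1 \<Longrightarrow> grid \<tau> n (uniform_grid \<tau> n)"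
  by (auto simp: grid_def uniform_grid_def divide_strict_right_mono)

lemma mesh_uniform_grid:
  assumes "\<tau> > 0"
  shows "(\<lambda>n. mesh n (uniform_grid \<tau> n)) \<longlonglongrightarrow> 0"
proof (rule Lim_transform_eventually)
  show "(\<lambda>n. \<tau> / real n) \<longlonglongrightarrow> 0"
    by (rule lim_const_over_n)
  show "\<forall>\<^sub>F n in sequentially. \<tau> / real n = mesh n (uniform_grid \<tau> n)"
    using eventually_gt_at_top[of 0]
  proof eventually_elim
    case (elim n)
    have "\<bar>uniform_grid \<tau> n i - uniform_grid \<tau> n (i - 1)\<bar> = \<tau> / real n" if "i \<in> {1..n}" for i
    proof -
      have "uniform_grid \<tau> n i - uniform_grid \<tau> n (i - 1) = \<tau> / real n"
        using that elim by (simp add: uniform_grid_def of_nat_diff field_simps)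
      then show ?thesis using assms by simp
    qed
    then have "mesh n (uniform_grid \<tau> n) = (SUP i\<in>{1..n}. \<tau> / real n)"
      unfolding mesh_def by (intro SUP_cong refl)
    then show ?case
      using elim by simp
  qed
qed

section \<open>Quadrature of continuous functions against signed measures\<close>

text \<open>\<open>quadrature t n \<nu> x\<close> is the integral of \<open>x\<close> against the discretization
  \<open>\<Sum>\<^sub>i \<nu>(T\<^sub>i) \<delta>\<^bsub>t\<^sub>i\<^esub>\<close> of \<open>\<nu>\<close>, where \<open>T\<^sub>i\<close> is the \<open>i\<close>-th cell of the grid \<open>t\<close>.\<close>

definition quadrature ::
  "(nat \<Rightarrow> real) \<Rightarrow> nat \<Rightarrow> real signed_measure \<Rightarrow> (real \<Rightarrow> real) \<Rightarrow> real" where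
  "quadrature t n \<nu> x = (\<Sum>i=1..n. smeasure \<nu> (cell t i) * x (t i))"

lemma bounded_linear_smeasure:
  assumes "A \<in> sets borel"
  shows "bounded_linear (\<lambda>\<nu>. smeasure \<nu> A)"
proof (rule bounded_linear_intro[where K=1])
  fix \<nu> :: "'a signed_measure"
  show "norm (smeasure \<nu> A) \<le> norm \<nu> * 1"
    using abs_smeasure_le_variation[OF assms, of \<nu>] variation_mono[OF assms, of UNIV \<nu>]
    by (simp add: norm_signed_measure_def)
qed simp_all

lemma bounded_linear_quadrature: "bounded_linear (\<lambda>\<nu>. quadrature t n \<nu> x)"
  unfolding quadrature_def
  by (intro bounded_linear_sum bounded_linear_mult_const bounded_linear_smeasure) simp

lemma variation_UN_finite:
  assumes "finite I" "disjoint_family_on A I" "\<And>i. i \<in> I \<Longrightarrow> A i \<in> sets borel"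
  shows "variation \<nu> (\<Union>i\<in>I. A i) = (\<Sum>i\<in>I. variation \<nu> (A i))"
  using assms
proof (induction rule: finite_induct)
  case (insert i I)
  have "A i \<inter> (\<Union>i\<in>I. A i) = {}" "disjoint_family_on A I"
    using insert by (auto simp: disjoint_family_on_def)
  then show ?case
    using insert by (simp add: variation_Un sets.finite_UN)
qed simp

lemma sum_variation_cell_le:
  assumes "grid \<tau> n t" "n \<ge> 1"
  shows "(\<Sum>i=1..n. variation \<nu> (cell t i)) \<le> norm \<nu>"
proof -
  have "(\<Sum>i=1..n. variation \<nu> (cell t i)) = variation \<nu> (\<Union>i\<in>{1..n}. cell t i)"
    by (rule variation_UN_finite[symmetric]) (use disjoint_cell[OF assms(1)] in auto)
  also have "\<dots> \<le> norm \<nu>"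
    unfolding norm_signed_measure_def UN_cell[OF assms] by (rule variation_mono) auto
  finally show ?thesis .
qed

lemma abs_sum_cells_le:
  assumes "grid \<tau> n t" "n \<ge> 1" and c: "\<And>i. i \<in> {1..n} \<Longrightarrow> \<bar>c i\<bar> \<le> \<delta>"
  shows "\<bar>\<Sum>i=1..n. smeasure \<nu> (cell t i) * c i\<bar> \<le> \<delta> * norm \<nu>"
proof -
  have \<delta>: "0 \<le> \<delta>" using c[of 1] assms(2) by auto
  have "\<bar>\<Sum>i=1..n. smeasure \<nu> (cell t i) * c i\<bar> \<le> (\<Sum>i=1..n. variation \<nu> (cell t i) * \<delta>)"
    using c by (intro sum_abs[THEN order_trans] sum_mono)
      (simp add: abs_mult mult_mono abs_smeasure_le_variation variation_nonneg)
  also have "\<dots> = \<delta> * (\<Sum>i=1..n. variation \<nu> (cell t i))"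
    by (simp add: sum_distrib_left mult.commute)
  also have "\<dots> \<le> \<delta> * norm \<nu>"
    by (intro mult_left_mono sum_variation_cell_le[OF assms(1,2)] \<delta>)
  finally show ?thesis .
qed

lemma finite_measure_pos_part: "finite_measure (pos_part \<mu>)"
  by (rule finite_measureI) (simp add: emeasure_pos_part)

lemma step_integral_error:
  assumes M: "finite_measure M" "sets M = sets borel"
    and g: "grid \<tau> n t" "n \<ge> 1" and x: "continuous_on {0..\<tau>} x"
    and le: "\<And>i s. i \<in> {1..n} \<Longrightarrow> s \<in> cell t i \<Longrightarrow> \<bar>c i - x s\<bar> \<le> \<delta>"
  shows "\<bar>(\<Sum>i=1..n. measure M (cell t i) * c i) - (LINT s:{0..\<tau>}|M. x s)\<bar>
    \<le> \<delta> * (\<Sum>i=1..n. measure M (cell t i))"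
proof -
  interpret finite_measure M by (rule M)
  note [measurable_cong] = M(2)
  have bd: "\<exists>b. \<forall>s\<in>{0..\<tau>}. norm (x s) \<le> b"
    using compact_imp_bounded[OF compact_continuous_image[OF x compact_Icc]] by (auto simp: bounded_iff)
  then obtain b where b: "\<And>s. s \<in> {0..\<tau>} \<Longrightarrow> norm (x s) \<le> b" by blast
  have meas: "(\<lambda>s. indicator {0..\<tau>} s *\<^sub>R x s) \<in> borel_measurable M"
    using borel_measurable_continuous_on_indicator[OF _ x] M(2) by (simp cong: measurable_cong_sets)
  have int: "set_integrable M {0..\<tau>} x"
    unfolding set_integrable_def
  proof (rule integrable_const_bound[where B="\<bar>b\<bar>"])
    show "AE s in M. norm (indicator {0..\<tau>} s *\<^sub>R x s) \<le> \<bar>b\<bar>"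
    proof (rule AE_I2)
      fix s
      show "norm (indicator {0..\<tau>} s *\<^sub>R x s) \<le> \<bar>b\<bar>"
        using b[of s] by (cases "s \<in> {0..\<tau>}") auto
    qed
  qed (rule meas)
  have intc: "set_integrable M (cell t i) x" if "i \<in> {1..n}" for i
    by (rule set_integrable_subset[OF int _ cell_subset[OF g(1) that]]) (simp add: M(2))
  have "(LINT s:{0..\<tau>}|M. x s) = (\<Sum>i=1..n. LINT s:cell t i|M. x s)"
    unfolding UN_cell[OF g, symmetric]
    by (rule set_integral_finite_Union) (use disjoint_cell[OF g(1)] intc in \<open>auto simp: M(2)\<close>)
  then have "\<bar>(\<Sum>i=1..n. measure M (cell t i) * c i) - (LINT s:{0..\<tau>}|M. x s)\<bar>
    = \<bar>\<Sum>i=1..n. measure M (cell t i) * c i - (LINT s:cell t i|M. x s)\<bar>"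
    by (simp add: sum_subtractf)
  also have "\<dots> \<le> (\<Sum>i=1..n. \<bar>measure M (cell t i) * c i - (LINT s:cell t i|M. x s)\<bar>)"
    by (rule sum_abs)
  also have "\<dots> \<le> (\<Sum>i=1..n. \<delta> * measure M (cell t i))"
  proof (rule sum_mono)
    fix i assume i: "i \<in> {1..n}"
    have c: "set_integrable M (cell t i) (\<lambda>s. r)" for r :: real
      by (simp add: set_integrable_def M(2) emeasure_eq_measure)
    have cI: "(LINT s:cell t i|M. r) = measure M (cell t i) * r" for r :: real
      by (simp add: set_lebesgue_integral_def M(2))
    have "measure M (cell t i) * c i - (LINT s:cell t i|M. x s) = (LINT s:cell t i|M. c i - x s)"
      using set_integral_diff(2)[OF c[of "c i"] intc[OF i]] by (simp add: cI)
    also have "\<bar>\<dots>\<bar> \<le> (LINT s:cell t i|M. \<bar>c i - x s\<bar>)"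
      using set_integral_norm_bound[OF set_integral_diff(1)[OF c[of "c i"] intc[OF i]]] by simp
    also have "\<dots> \<le> (LINT s:cell t i|M. \<delta>)"
      by (intro set_integral_mono c set_integrable_abs set_integral_diff(1) intc i le)
    also have "\<dots> = \<delta> * measure M (cell t i)" by (simp add: cI)
    finally show "\<bar>measure M (cell t i) * c i - (LINT s:cell t i|M. x s)\<bar> \<le> \<delta> * measure M (cell t i)" .
  qed
  finally show ?thesis by (simp add: sum_distrib_left)
qed

text \<open>The basic error bound: if the constant \<open>c i\<close> is within \<open>\<delta>\<close> of \<open>x\<close> throughout the \<open>i\<close>-th
  cell, the corresponding step function has the same integral as \<open>x\<close> up to \<open>\<delta>\<close> times the total
  variation. The \<open>c i\<close> are left arbitrary because below they come from integrals that have
  themselves been discretized.\<close>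

lemma quadrature_error:
  assumes g: "grid \<tau> n t" "n \<ge> 1" and x: "continuous_on {0..\<tau>} x"
    and le: "\<And>i s. i \<in> {1..n} \<Longrightarrow> s \<in> cell t i \<Longrightarrow> \<bar>c i - x s\<bar> \<le> \<delta>"
  shows "\<bar>(\<Sum>i=1..n. smeasure \<nu> (cell t i) * c i) - pairing {0..\<tau>} \<nu> x\<bar> \<le> \<delta> * norm \<nu>"
proof -
  have \<delta>: "0 \<le> \<delta>" using le[OF _ node_in_cell[OF g(1)], of 1] g(2) by auto
  let ?p = "pos_part \<nu>" and ?n = "neg_part \<nu>"
  have neg: "finite_measure ?n" "sets ?n = sets borel"
    by (simp_all add: neg_part_def finite_measure_pos_part)
  let ?err = "\<lambda>M. (\<Sum>i=1..n. measure M (cell t i) * c i) - (LINT s:{0..\<tau>}|M. x s)"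
  have "\<bar>(\<Sum>i=1..n. smeasure \<nu> (cell t i) * c i) - pairing {0..\<tau>} \<nu> x\<bar> = \<bar>?err ?p - ?err ?n\<bar>"
    by (simp add: smeasure_Jordan(1) pairing_def sum_subtractf left_diff_distrib)
  also have "\<dots> \<le> \<delta> * (\<Sum>i=1..n. measure ?p (cell t i)) + \<delta> * (\<Sum>i=1..n. measure ?n (cell t i))"
    using step_integral_error[where c=c, OF finite_measure_pos_part[of \<nu>] sets_pos_part g x le]
      step_integral_error[where c=c, OF neg g x le] by linarith
  also have "\<dots> = \<delta> * (\<Sum>i=1..n. variation \<nu> (cell t i))"
    by (simp add: smeasure_Jordan(2) sum.distrib distrib_left)
  also have "\<dots> \<le> \<delta> * norm \<nu>"
    by (rule mult_left_mono[OF sum_variation_cell_le[OF g] \<delta>])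
  finally show ?thesis .
qed

lemma quadrature_uniform:
  assumes g: "\<And>n. n \<ge> 1 \<Longrightarrow> grid \<tau> n (t n)" and mesh: "(\<lambda>n. mesh n (t n)) \<longlonglongrightarrow> 0"
    and x: "continuous_on {0..\<tau>} x" and e: "e > 0"
  shows "\<forall>\<^sub>F n in sequentially. \<forall>\<nu>. \<bar>quadrature (t n) n \<nu> x - pairing {0..\<tau>} \<nu> x\<bar> \<le> e * norm \<nu>"
proof -
  have "uniformly_continuous_on {0..\<tau>} x"
    by (rule compact_uniformly_continuous[OF x compact_Icc])
  then obtain d where d: "d > 0"
    "\<And>s s'. s \<in> {0..\<tau>} \<Longrightarrow> s' \<in> {0..\<tau>} \<Longrightarrow> dist s' s < d \<Longrightarrow> dist (x s') (x s) < e"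
    using e unfolding uniformly_continuous_on_def by metis
  have "\<forall>\<^sub>F n in sequentially. mesh n (t n) < d"
    using mesh d(1) by (rule order_tendstoD)
  then show ?thesis
    using eventually_ge_at_top[of 1]
  proof eventually_elim
    case (elim n)
    note gn = g[OF elim(2)]
    have "\<bar>x (t n i) - x s\<bar> \<le> e" if "i \<in> {1..n}" "s \<in> cell (t n) i" for i s
    proof -
      have "s \<in> {0..\<tau>}" "t n i \<in> {0..\<tau>}"
        using cell_subset[OF gn that(1)] that node_in_cell[OF gn that(1)] by auto
      moreover have "dist (t n i) s < d"
        using dist_node_le_mesh[OF gn that] elim(1) by (simp add: dist_real_def)
      ultimately show ?thesis
        using d(2)[of s "t n i"] by (simp add: dist_real_def)
    qed
    then show ?case
      unfolding quadrature_def by (intro allI quadrature_error[OF gn elim(2) x])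
  qed
qed

lemma quadrature_tendsto:
  assumes "\<And>n. n \<ge> 1 \<Longrightarrow> grid \<tau> n (t n)" "(\<lambda>n. mesh n (t n)) \<longlonglongrightarrow> 0" "continuous_on {0..\<tau>} x"
  shows "(\<lambda>n. quadrature (t n) n \<nu> x) \<longlonglongrightarrow> pairing {0..\<tau>} \<nu> x"
proof (rule tendstoI)
  fix e :: real assume e: "e > 0"
  define e' where "e' = e / (norm \<nu> + 1)"
  have e': "e' > 0" "e' * norm \<nu> < e"
    using e by (auto simp: e'_def field_simps add_pos_nonneg)
  show "\<forall>\<^sub>F n in sequentially. dist (quadrature (t n) n \<nu> x) (pairing {0..\<tau>} \<nu> x) < e"
  proof (rule eventually_mono)
    show "\<forall>\<^sub>F n in sequentially. \<forall>\<nu>. \<bar>quadrature (t n) n \<nu> x - pairing {0..\<tau>} \<nu> x\<bar> \<le> e' * norm \<nu>"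
      by (rule quadrature_uniform[OF assms(1) assms(2,3) e'(1)])
  next
    fix n assume "\<forall>\<nu>. \<bar>quadrature (t n) n \<nu> x - pairing {0..\<tau>} \<nu> x\<bar> \<le> e' * norm \<nu>"
    then show "dist (quadrature (t n) n \<nu> x) (pairing {0..\<tau>} \<nu> x) < e"
      using e'(2) by (auto simp: dist_real_def intro: le_less_trans)
  qed
qed

lemma quadrature_uniform_grid_tendsto:
  "(\<tau>::real) > 0 \<Longrightarrow> continuous_on {0..\<tau>} x \<Longrightarrow>
    (\<lambda>n. quadrature (uniform_grid \<tau> n) n \<nu> x) \<longlonglongrightarrow> pairing {0..\<tau>} \<nu> x"
  by (rule quadrature_tendsto) (auto intro: grid_uniform_grid mesh_uniform_grid)

text \<open>The Jordan decomposition is not additive in the measure, so linearity of \<open>pairing\<close> in the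
  measure is not immediate from the definition. It is inherited, like the norm bounds, from the
  finite sums of \<open>quadrature\<close> by passing to the limit.\<close>

lemma abs_pairing_diff_le:
  fixes \<tau> :: real
  assumes \<tau>: "\<tau> > 0" and x: "continuous_on {0..\<tau>} x" and y: "continuous_on {0..\<tau>} y"
    and le: "\<And>s. s \<in> {0..\<tau>} \<Longrightarrow> \<bar>x s - y s\<bar> \<le> \<delta>"
  shows "\<bar>pairing {0..\<tau>} \<nu> x - pairing {0..\<tau>} \<nu> y\<bar> \<le> \<delta> * norm \<nu>"
proof (rule tendsto_upperbound)
  show "(\<lambda>n. \<bar>quadrature (uniform_grid \<tau> n) n \<nu> x - quadrature (uniform_grid \<tau> n) n \<nu> y\<bar>)
      \<longlonglongrightarrow> \<bar>pairing {0..\<tau>} \<nu> x - pairing {0..\<tau>} \<nu> y\<bar>"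
    by (intro tendsto_intros quadrature_uniform_grid_tendsto assms)
  show "\<forall>\<^sub>F n in sequentially.
      \<bar>quadrature (uniform_grid \<tau> n) n \<nu> x - quadrature (uniform_grid \<tau> n) n \<nu> y\<bar> \<le> \<delta> * norm \<nu>"
    using eventually_ge_at_top[of 1]
  proof eventually_elim
    case (elim n)
    note g = grid_uniform_grid[OF \<tau> elim]
    show ?case
      using abs_sum_cells_le[OF g elim, of "\<lambda>i. x (uniform_grid \<tau> n i) - y (uniform_grid \<tau> n i)" \<delta> \<nu>]
        le[OF grid_in_interval[OF g]]
      by (simp add: quadrature_def right_diff_distrib sum_subtractf)
  qed
qed simp

lemma abs_pairing_le:
  fixes \<tau> :: real
  assumes "\<tau> > 0" "continuous_on {0..\<tau>} x" "\<And>s. s \<in> {0..\<tau>} \<Longrightarrow> \<bar>x s\<bar> \<le> b"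
  shows "\<bar>pairing {0..\<tau>} \<nu> x\<bar> \<le> b * norm \<nu>"
proof -
  have "pairing {0..\<tau>} \<nu> (\<lambda>_. 0) = 0"
    by (simp add: pairing_def set_lebesgue_integral_def)
  with abs_pairing_diff_le[OF assms(1,2) continuous_on_const[of _ 0], of b \<nu>] assms(3)
  show ?thesis by simp
qed

lemma bounded_linear_pairing:
  fixes \<tau> :: real
  assumes \<tau>: "\<tau> > 0" and x: "continuous_on {0..\<tau>} x"
  shows "bounded_linear (\<lambda>\<nu>. pairing {0..\<tau>} \<nu> x)"
proof -
  note lim = quadrature_uniform_grid_tendsto[OF \<tau> x]
  have bl: "bounded_linear (\<lambda>\<nu>. quadrature (uniform_grid \<tau> n) n \<nu> x)" for n
    by (rule bounded_linear_quadrature)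
  obtain b where b: "\<And>s. s \<in> {0..\<tau>} \<Longrightarrow> \<bar>x s\<bar> \<le> b"
    using compact_imp_bounded[OF compact_continuous_image[OF x compact_Icc]]
    by (auto simp: bounded_iff simp del: atLeastAtMost_iff)
  show ?thesis
  proof (rule bounded_linear_intro[where K=b])
    fix \<nu> \<rho> :: "real signed_measure" and c :: real
    show "pairing {0..\<tau>} (\<nu> + \<rho>) x = pairing {0..\<tau>} \<nu> x + pairing {0..\<tau>} \<rho> x"
      by (rule LIMSEQ_unique[OF lim])
        (simp add: linear_add[OF bounded_linear.linear[OF bl]] tendsto_add lim)
    show "pairing {0..\<tau>} (c *\<^sub>R \<nu>) x = c *\<^sub>R pairing {0..\<tau>} \<nu> x"
      by (rule LIMSEQ_unique[OF lim])
        (simp add: linear_scale[OF bounded_linear.linear[OF bl]] tendsto_mult_left lim)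
    show "norm (pairing {0..\<tau>} \<nu> x) \<le> norm \<nu> * b"
      using abs_pairing_le[OF \<tau> x b] by (simp add: mult.commute)
  qed
qed

text \<open>Quadrature converges in the operator norm: the error is bounded by a null sequence times the
  total variation.\<close>

lemma quadrature_uniform_seq:
  assumes g: "\<And>n. n \<ge> 1 \<Longrightarrow> grid \<tau> n (t n)" and mesh: "(\<lambda>n. mesh n (t n)) \<longlonglongrightarrow> 0"
    and \<tau>: "\<tau> > 0" and x: "continuous_on {0..\<tau>} x"
  obtains s where "s \<longlonglongrightarrow> 0"
    "\<And>n \<nu>. \<bar>quadrature (t n) n \<nu> x - pairing {0..\<tau>} \<nu> x\<bar> \<le> s n * norm \<nu>"
proof -
  let ?f = "\<lambda>n \<nu>. quadrature (t n) n \<nu> x - pairing {0..\<tau>} \<nu> x"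
  have bl: "bounded_linear (?f n)" for n
    by (intro bounded_linear_sub bounded_linear_quadrature bounded_linear_pairing \<tau> x)
  show ?thesis
  proof (rule that[of "\<lambda>n. onorm (?f n)"])
    show "(\<lambda>n. onorm (?f n)) \<longlonglongrightarrow> 0"
    proof (rule tendstoI)
      fix e :: real assume "e > 0"
      then have e: "e / 2 > 0" by simp
      have "\<forall>\<^sub>F n in sequentially. \<forall>\<nu>. \<bar>?f n \<nu>\<bar> \<le> e / 2 * norm \<nu>"
        by (rule quadrature_uniform[OF g mesh x e])
      then show "\<forall>\<^sub>F n in sequentially. dist (onorm (?f n)) 0 < e"
      proof eventually_elim
        case (elim n)
        then have "onorm (?f n) \<le> e / 2" using e by (intro onorm_bound) auto
        then show ?case using e onorm_pos_le[OF bl[of n]] by simp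
      qed
    qed
    show "\<bar>?f n \<nu>\<bar> \<le> onorm (?f n) * norm \<nu>" for n \<nu>
      using onorm[OF bl[of n], of \<nu>] by simp
  qed
qed

section \<open>Point masses\<close>

lemma signed_measures_on_subspace: "subspace (signed_measures_on T)"
  by (auto simp: signed_measures_on_def subspace_def)

text \<open>The unit mass at \<open>s\<close>.\<close>

lift_definition dirac :: "'a::topological_space \<Rightarrow> 'a signed_measure"
  is "\<lambda>s A. if A \<in> sets borel then indicator A s else (0::real)"
proof (intro conjI)
  fix s :: 'a
  show "signed_borel_measure (\<lambda>A. if A \<in> sets borel then indicator A s else (0::real))"
    unfolding signed_borel_measure_def
  proof (intro allI impI)
    fix A :: "nat \<Rightarrow> 'a set" assume A: "range A \<subseteq> sets borel" "disjoint_family A"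
    then have m: "A i \<in> sets borel" "(\<Union>i. A i) \<in> sets borel" for i by auto
    show "(\<lambda>i. if A i \<in> sets borel then indicator (A i) s else 0) sums
        (if (\<Union>i. A i) \<in> sets borel then indicator (\<Union>i. A i) s else (0::real))"
      using m indicator_sums[of A s] A(2) by (auto simp: disjoint_family_on_def)
  qed
qed simp

lemma smeasure_dirac: "A \<in> sets borel \<Longrightarrow> smeasure (dirac s) A = indicator A s"
  by transfer simp

lemma dirac_in_signed_measures_on: "s \<in> T \<Longrightarrow> dirac s \<in> signed_measures_on T"
  by (auto simp: signed_measures_on_def smeasure_dirac indicator_def)

lemma pairing_dirac:
  fixes \<tau> :: real
  assumes \<tau>: "\<tau> > 0" and x: "continuous_on {0..\<tau>} x" and s: "s \<in> {0..\<tau>}"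
  shows "pairing {0..\<tau>} (dirac s) x = x s"
proof -
  let ?t = "uniform_grid \<tau>"
  have "(\<lambda>n. quadrature (?t n) n (dirac s) x) \<longlonglongrightarrow> x s"
  proof (rule tendstoI)
    fix e :: real assume e: "e > 0"
    obtain d where d: "d > 0" "\<And>u. u \<in> {0..\<tau>} \<Longrightarrow> dist u s < d \<Longrightarrow> dist (x u) (x s) < e"
      using x s e unfolding continuous_on_iff by metis
    have "\<forall>\<^sub>F n in sequentially. mesh n (?t n) < d"
      using mesh_uniform_grid[OF \<tau>] d(1) by (rule order_tendstoD)
    then show "\<forall>\<^sub>F n in sequentially. dist (quadrature (?t n) n (dirac s) x) (x s) < e"
      using eventually_ge_at_top[of 1]
    proof eventually_elim
      case (elim n)
      note g = grid_uniform_grid[OF \<tau> elim(2)]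
      obtain i where i: "i \<in> {1..n}" "s \<in> cell (?t n) i"
        using UN_cell[OF g elim(2)] s by blast
      \<comment> \<open>only the cell that contains \<open>s\<close> contributes\<close>
      have "indicator (cell (?t n) j) s = (if j = i then 1 else 0 :: real)" if "j \<in> {1..n}" for j
        using disjoint_family_onD[OF disjoint_cell[OF g] i(1) that] i(2) by (auto simp: indicator_def)
      then have "quadrature (?t n) n (dirac s) x = (\<Sum>j=1..n. if j = i then x (?t n j) else 0)"
        unfolding quadrature_def by (intro sum.cong) (simp_all add: smeasure_dirac)
      also have "\<dots> = x (?t n i)" using i(1) by simp
      finally show ?case
        using d(2)[of "?t n i"] dist_node_le_mesh[OF g i] elim(1) grid_in_interval[OF g, of i] i(1)
        by (simp add: dist_real_def)
    qed
  qed
  then show ?thesis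
    using LIMSEQ_unique[OF quadrature_uniform_grid_tendsto[OF \<tau> x]] by simp
qed

section \<open>The energy form of a covariance kernel\<close>

text \<open>The double integral of \<open>K\<close> against the discretizations of \<open>\<nu>\<close> and \<open>\<rho>\<close>, that is, of the
  step kernel \<open>K\<^sup>n\<close> against \<open>\<nu> \<otimes> \<rho>\<close>; it is the quadratic part of the contrast.\<close>

definition quadrature2 ::
  "(nat \<Rightarrow> real) \<Rightarrow> nat \<Rightarrow> (real \<Rightarrow> real \<Rightarrow> real) \<Rightarrow> real signed_measure \<Rightarrow> real signed_measure \<Rightarrow> real" where
  "quadrature2 t n K \<nu> \<rho> = quadrature t n \<nu> (\<lambda>s. quadrature t n \<rho> (K s))"

lemma quadrature2_eq:
  "quadrature2 t n K \<nu> \<rho>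
    = (\<Sum>i=1..n. \<Sum>j=1..n. smeasure \<nu> (cell t i) * smeasure \<rho> (cell t j) * K (t i) (t j))"
  by (simp add: quadrature2_def quadrature_def sum_distrib_left mult.assoc)

lemma contrast_eq:
  "contrast K \<mu> n t x \<theta> = quadrature t n (\<mu> \<theta>) x - quadrature2 t n K (\<mu> \<theta>) (\<mu> \<theta>) / 2"
  by (simp add: contrast_def quadrature_def quadrature2_eq)

lemma bounded_bilinear_quadrature2: "bounded_bilinear (quadrature2 t n K)"
proof
  fix \<nu> \<nu>' \<rho> \<rho>' :: "real signed_measure" and c :: real
  show "quadrature2 t n K (\<nu> + \<nu>') \<rho> = quadrature2 t n K \<nu> \<rho> + quadrature2 t n K \<nu>' \<rho>"
    "quadrature2 t n K \<nu> (\<rho> + \<rho>') = quadrature2 t n K \<nu> \<rho> + quadrature2 t n K \<nu> \<rho>'"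
    unfolding quadrature2_eq smeasure_add by (simp_all only: distrib_left distrib_right sum.distrib)
  show "quadrature2 t n K (c *\<^sub>R \<nu>) \<rho> = c *\<^sub>R quadrature2 t n K \<nu> \<rho>"
    "quadrature2 t n K \<nu> (c *\<^sub>R \<rho>) = c *\<^sub>R quadrature2 t n K \<nu> \<rho>"
    unfolding quadrature2_eq smeasure_scaleR real_scaleR_def sum_distrib_left
    by (simp_all only: mult.assoc mult.left_commute)
  have le: "\<bar>smeasure \<nu> (cell t i)\<bar> \<le> norm \<nu>" for \<nu> :: "real signed_measure" and i
    using abs_smeasure_le_variation[of "cell t i" \<nu>] variation_mono[of "cell t i" UNIV \<nu>]
    by (simp add: norm_signed_measure_def)
  show "\<exists>C. \<forall>\<nu> \<rho>. norm (quadrature2 t n K \<nu> \<rho>) \<le> norm \<nu> * norm \<rho> * C"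
  proof (intro exI allI)
    fix \<nu> \<rho> :: "real signed_measure"
    have "norm (quadrature2 t n K \<nu> \<rho>) \<le> (\<Sum>i=1..n. \<Sum>j=1..n. norm \<nu> * norm \<rho> * \<bar>K (t i) (t j)\<bar>)"
      unfolding quadrature2_eq real_norm_def
      by (intro sum_abs[THEN order_trans] sum_mono) (unfold abs_mult, intro mult_mono le, simp_all)
    then show "norm (quadrature2 t n K \<nu> \<rho>)
        \<le> norm \<nu> * norm \<rho> * (\<Sum>i=1..n. \<Sum>j=1..n. \<bar>K (t i) (t j)\<bar>)"
      by (simp add: sum_distrib_left)
  qed
qed

text \<open>The step kernel \<open>K\<^sup>n\<close>, equal to \<open>K(t\<^sub>i, t\<^sub>j)\<close> on the product of the \<open>i\<close>-th and the \<open>j\<close>-th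
  cell, is within \<open>\<delta>\<close> of \<open>K\<close> at every point of the square.\<close>

definition oscillation_le :: "(real \<Rightarrow> real \<Rightarrow> real) \<Rightarrow> (nat \<Rightarrow> real) \<Rightarrow> nat \<Rightarrow> real \<Rightarrow> bool" where
  "oscillation_le K t n \<delta> \<longleftrightarrow>
     (\<forall>i\<in>{1..n}. \<forall>j\<in>{1..n}. \<forall>s\<in>cell t i. \<forall>u\<in>cell t j. \<bar>K (t i) (t j) - K s u\<bar> \<le> \<delta>)"

text \<open>A continuous positive semidefinite kernel on \<open>[0, \<tau>]\<^sup>2\<close>. Symmetry is required for all real
  arguments, which costs nothing since a covariance function is symmetric everywhere.\<close>

locale covariance_kernel =
  fixes \<tau> :: real and K :: "real \<Rightarrow> real \<Rightarrow> real"
  assumes \<tau>: "\<tau> > 0"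
    and cont: "continuous_on ({0..\<tau>} \<times> {0..\<tau>}) (\<lambda>p. K (fst p) (snd p))"
    and sym: "\<And>s u. K s u = K u s"
    and psd: "\<And>(n::nat) c t. (\<And>i. i \<in> {1..n} \<Longrightarrow> t i \<in> {0..\<tau>}) \<Longrightarrow>
      0 \<le> (\<Sum>i=1..n. \<Sum>j=1..n. c i * c j * K (t i) (t j))"
begin

text \<open>The bilinear form \<open>\<langle>\<nu>, K\<rho>\<rangle>\<close> on signed measures.\<close>

abbreviation energy :: "real signed_measure \<Rightarrow> real signed_measure \<Rightarrow> real" where
  "energy \<nu> \<rho> \<equiv> pairing {0..\<tau>} \<nu> (cov_op {0..\<tau>} K \<rho>)"

lemma uniform:
  assumes "e > 0"
  obtains d where "d > 0"
    "\<And>s s' u u'. s \<in> {0..\<tau>} \<Longrightarrow> s' \<in> {0..\<tau>} \<Longrightarrow> u \<in> {0..\<tau>} \<Longrightarrow> u' \<in> {0..\<tau>} \<Longrightarrow>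
      \<bar>s' - s\<bar> < d \<Longrightarrow> \<bar>u' - u\<bar> < d \<Longrightarrow> \<bar>K s' u' - K s u\<bar> < e"
proof -
  have "uniformly_continuous_on ({0..\<tau>} \<times> {0..\<tau>}) (\<lambda>p. K (fst p) (snd p))"
    by (intro compact_uniformly_continuous cont compact_Times compact_Icc)
  then obtain d where d: "d > 0"
    "\<And>p p'. p \<in> {0..\<tau>} \<times> {0..\<tau>} \<Longrightarrow> p' \<in> {0..\<tau>} \<times> {0..\<tau>} \<Longrightarrow> dist p' p < d \<Longrightarrow>
      dist (K (fst p') (snd p')) (K (fst p) (snd p)) < e"
    using assms unfolding uniformly_continuous_on_def by metis
  show ?thesis
  proof (rule that[of "d / 2"])
    fix s s' u u' :: real
    assume *: "s \<in> {0..\<tau>}" "s' \<in> {0..\<tau>}" "u \<in> {0..\<tau>}" "u' \<in> {0..\<tau>}"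
      "\<bar>s' - s\<bar> < d / 2" "\<bar>u' - u\<bar> < d / 2"
    have "dist (s', u') (s, u) \<le> dist s' s + dist u' u"
      unfolding dist_prod_def by (simp add: sqrt_sum_squares_le_sum)
    also have "\<dots> < d" using * by (simp add: dist_real_def)
    finally show "\<bar>K s' u' - K s u\<bar> < e"
      using d(2)[of "(s, u)" "(s', u')"] * by (simp add: dist_real_def)
  qed (use d in simp)
qed

lemma cont_section:
  assumes "s \<in> {0..\<tau>}"
  shows "continuous_on {0..\<tau>} (K s)"
proof -
  have "continuous_on {0..\<tau>} ((\<lambda>p. K (fst p) (snd p)) \<circ> Pair s)"
    by (intro continuous_on_compose continuous_intros continuous_on_subset[OF cont])
      (use assms in auto)
  then show ?thesis by (simp add: o_def)
qed

lemma cont_cov_op: "continuous_on {0..\<tau>} (cov_op {0..\<tau>} K \<rho>)"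
  unfolding continuous_on_iff
proof (intro ballI allI impI)
  fix s e :: real assume s: "s \<in> {0..\<tau>}" and e: "e > 0"
  define e' where "e' = e / (norm \<rho> + 1)"
  have e': "e' > 0" "e' * norm \<rho> < e"
    using e by (auto simp: e'_def field_simps add_pos_nonneg)
  obtain d where d: "d > 0"
    "\<And>s s' u u'. s \<in> {0..\<tau>} \<Longrightarrow> s' \<in> {0..\<tau>} \<Longrightarrow> u \<in> {0..\<tau>} \<Longrightarrow> u' \<in> {0..\<tau>} \<Longrightarrow>
      \<bar>s' - s\<bar> < d \<Longrightarrow> \<bar>u' - u\<bar> < d \<Longrightarrow> \<bar>K s' u' - K s u\<bar> < e'"
    using uniform[OF e'(1)] by blast
  show "\<exists>d>0. \<forall>s'\<in>{0..\<tau>}. dist s' s < d \<longrightarrow>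
      dist (cov_op {0..\<tau>} K \<rho> s') (cov_op {0..\<tau>} K \<rho> s) < e"
  proof (intro exI[of _ d] conjI ballI impI d(1))
    fix s' assume s': "s' \<in> {0..\<tau>}" "dist s' s < d"
    have "\<bar>K s' u - K s u\<bar> \<le> e'" if "u \<in> {0..\<tau>}" for u
      using d(2)[of s s' u u] s s' that d(1) by (simp add: dist_real_def)
    then have "\<bar>cov_op {0..\<tau>} K \<rho> s' - cov_op {0..\<tau>} K \<rho> s\<bar> \<le> e' * norm \<rho>"
      unfolding cov_op_def by (intro abs_pairing_diff_le \<tau> cont_section s s')
    with e'(2) show "dist (cov_op {0..\<tau>} K \<rho> s') (cov_op {0..\<tau>} K \<rho> s) < e"
      by (simp add: dist_real_def)
  qed
qed

lemma quadrature2_error: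
  assumes g: "grid \<tau> n t" "n \<ge> 1" and osc: "oscillation_le K t n \<delta>"
  shows "\<bar>quadrature2 t n K \<nu> \<rho> - energy \<nu> \<rho>\<bar> \<le> \<delta> * norm \<nu> * norm \<rho>"
proof -
  have "\<bar>quadrature t n \<rho> (K (t i)) - cov_op {0..\<tau>} K \<rho> s\<bar> \<le> \<delta> * norm \<rho>"
    if "i \<in> {1..n}" "s \<in> cell t i" for i s
    unfolding quadrature_def cov_op_def
  proof (rule quadrature_error[OF g cont_section])
    show "s \<in> {0..\<tau>}" using that cell_subset[OF g(1)] by blast
  qed (use that osc in \<open>unfold oscillation_le_def, blast\<close>)
  from quadrature_error[where \<nu>=\<nu>, OF g cont_cov_op this]
  show ?thesis
    by (simp add: quadrature2_def quadrature_def[of t n \<nu>] mult.commute mult.left_commute)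
qed

text \<open>The observation contains the exact function \<open>K\<rho>\<close>, not its discretization. Passing from
  \<open>(t\<^sub>i, u)\<close> to \<open>(s, u)\<close> with \<open>s\<close> in the \<open>i\<close>-th cell goes through \<open>(t\<^sub>i, t\<^sub>j)\<close>, which
  accounts for the factor 2.\<close>

lemma quadrature_cov_op_error:
  assumes g: "grid \<tau> n t" "n \<ge> 1" and osc: "oscillation_le K t n \<delta>"
  shows "\<bar>quadrature t n \<nu> (cov_op {0..\<tau>} K \<rho>) - energy \<nu> \<rho>\<bar> \<le> 2 * \<delta> * norm \<nu> * norm \<rho>"
proof -
  have "\<bar>cov_op {0..\<tau>} K \<rho> (t i) - cov_op {0..\<tau>} K \<rho> s\<bar> \<le> 2 * \<delta> * norm \<rho>"
    if i: "i \<in> {1..n}" "s \<in> cell t i" for i s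
    unfolding cov_op_def
  proof (rule abs_pairing_diff_le[OF \<tau> cont_section cont_section])
    note node = node_in_cell[OF g(1) i(1)]
    show "t i \<in> {0..\<tau>}" "s \<in> {0..\<tau>}"
      using cell_subset[OF g(1) i(1)] i(2) node by auto
    fix u assume "u \<in> {0..\<tau>}"
    then obtain j where j: "j \<in> {1..n}" "u \<in> cell t j"
      using UN_cell[OF g] by blast
    have "\<bar>K (t i) (t j) - K (t i) u\<bar> \<le> \<delta>" "\<bar>K (t i) (t j) - K s u\<bar> \<le> \<delta>"
      using osc i j node unfolding oscillation_le_def by blast+
    then show "\<bar>K (t i) u - K s u\<bar> \<le> 2 * \<delta>" by linarith
  qed
  from quadrature_error[where \<nu>=\<nu>, OF g cont_cov_op this]
  show ?thesis
    by (simp add: quadrature_def mult.commute mult.left_commute)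
qed

lemma eventually_oscillation_le:
  assumes e: "e > 0"
  shows "\<forall>\<^sub>F n in sequentially. oscillation_le K (uniform_grid \<tau> n) n e"
proof -
  obtain d where d: "d > 0"
    "\<And>s s' u u'. s \<in> {0..\<tau>} \<Longrightarrow> s' \<in> {0..\<tau>} \<Longrightarrow> u \<in> {0..\<tau>} \<Longrightarrow> u' \<in> {0..\<tau>} \<Longrightarrow>
      \<bar>s' - s\<bar> < d \<Longrightarrow> \<bar>u' - u\<bar> < d \<Longrightarrow> \<bar>K s' u' - K s u\<bar> < e"
    using uniform[OF e] by blast
  have "\<forall>\<^sub>F n in sequentially. mesh n (uniform_grid \<tau> n) < d"
    using mesh_uniform_grid[OF \<tau>] d(1) by (rule order_tendstoD)
  then show ?thesis
    using eventually_ge_at_top[of 1]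
  proof eventually_elim
    case (elim n)
    let ?t = "uniform_grid \<tau> n"
    note g = grid_uniform_grid[OF \<tau> elim(2)]
    have near: "s \<in> {0..\<tau>} \<and> ?t i \<in> {0..\<tau>} \<and> \<bar>?t i - s\<bar> < d" if "i \<in> {1..n}" "s \<in> cell ?t i" for i s
      using dist_node_le_mesh[OF g that] cell_subset[OF g that(1)] that(2) node_in_cell[OF g that(1)]
        elim(1) by auto
    show ?case
      unfolding oscillation_le_def
    proof (intro ballI)
      fix i j s u assume "i \<in> {1..n}" "j \<in> {1..n}" "s \<in> cell ?t i" "u \<in> cell ?t j"
      then show "\<bar>K (?t i) (?t j) - K s u\<bar> \<le> e"
        using d(2)[of s "?t i" u "?t j"] near[of i s] near[of j u] by auto
    qed
  qed
qed

lemma quadrature2_tendsto: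
  "(\<lambda>n. quadrature2 (uniform_grid \<tau> n) n K \<nu> \<rho>) \<longlonglongrightarrow> energy \<nu> \<rho>"
proof (rule tendstoI)
  fix e :: real assume e: "e > 0"
  define e' where "e' = e / (norm \<nu> * norm \<rho> + 1)"
  have e': "e' > 0" "e' * norm \<nu> * norm \<rho> < e"
    using e by (auto simp: e'_def field_simps add_pos_nonneg)
  show "\<forall>\<^sub>F n in sequentially. dist (quadrature2 (uniform_grid \<tau> n) n K \<nu> \<rho>) (energy \<nu> \<rho>) < e"
    using eventually_oscillation_le[OF e'(1)] eventually_ge_at_top[of 1]
  proof eventually_elim
    case (elim n)
    show ?case
      using quadrature2_error[OF grid_uniform_grid[OF \<tau> elim(2)] elim(2,1), of \<nu> \<rho>] e'(2)
      by (simp add: dist_real_def)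
  qed
qed

lemma quadrature2_sym: "quadrature2 t n K \<nu> \<rho> = quadrature2 t n K \<rho> \<nu>"
  unfolding quadrature2_eq
  by (subst sum.swap) (intro sum.cong refl, simp add: sym ac_simps)

text \<open>Symmetry and positivity hold for the double sums and pass to the limit, so that Fubini's
  theorem is not needed.\<close>

lemma energy_sym: "energy \<nu> \<rho> = energy \<rho> \<nu>"
  by (rule LIMSEQ_unique[OF quadrature2_tendsto]) (subst quadrature2_sym, rule quadrature2_tendsto)

lemma energy_nonneg: "0 \<le> energy \<nu> \<nu>"
proof (rule tendsto_lowerbound[OF quadrature2_tendsto])
  show "\<forall>\<^sub>F n in sequentially. 0 \<le> quadrature2 (uniform_grid \<tau> n) n K \<nu> \<nu>"
    using eventually_ge_at_top[of 1]
  proof eventually_elim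
    case (elim n)
    show ?case
      unfolding quadrature2_eq
      by (rule psd[where t="uniform_grid \<tau> n" and c="\<lambda>i. smeasure \<nu> (cell (uniform_grid \<tau> n) i)"],
          rule grid_in_interval[OF grid_uniform_grid[OF \<tau> elim]]) simp
  qed
qed simp

lemma bounded_bilinear_energy: "bounded_bilinear energy"
proof -
  have lin: "bounded_linear (\<lambda>\<nu>. energy \<nu> \<rho>)" for \<rho>
    by (rule bounded_linear_pairing[OF \<tau> cont_cov_op])
  have "bounded ((\<lambda>p. K (fst p) (snd p)) ` ({0..\<tau>} \<times> {0..\<tau>}))"
    by (intro compact_imp_bounded compact_continuous_image cont compact_Times compact_Icc)
  then obtain b where b: "\<And>s u. s \<in> {0..\<tau>} \<Longrightarrow> u \<in> {0..\<tau>} \<Longrightarrow> \<bar>K s u\<bar> \<le> b"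
    by (auto simp: bounded_iff simp del: atLeastAtMost_iff)
  have add: "energy (\<nu> + \<nu>') \<rho> = energy \<nu> \<rho> + energy \<nu>' \<rho>"
    and scale: "energy (c *\<^sub>R \<nu>) \<rho> = c *\<^sub>R energy \<nu> \<rho>" for \<nu> \<nu>' \<rho> c
    using linear_add[OF bounded_linear.linear[OF lin]] linear_scale[OF bounded_linear.linear[OF lin]]
    by auto
  show ?thesis
  proof
    show "energy \<nu> (\<rho> + \<rho>') = energy \<nu> \<rho> + energy \<nu> \<rho>'" for \<nu> \<rho> \<rho>'
      using add[of \<rho> \<rho>' \<nu>] by (simp only: energy_sym[of \<nu>])
    show "energy \<nu> (c *\<^sub>R \<rho>) = c *\<^sub>R energy \<nu> \<rho>" for \<nu> \<rho> c
      using scale[of c \<rho> \<nu>] by (simp only: energy_sym[of \<nu>])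
    have "\<bar>energy \<nu> \<rho>\<bar> \<le> (b * norm \<rho>) * norm \<nu>" for \<nu> \<rho>
      by (intro abs_pairing_le \<tau> cont_cov_op)
        (unfold cov_op_def, intro abs_pairing_le \<tau> cont_section b)
    then show "\<exists>C. \<forall>\<nu> \<rho>. norm (energy \<nu> \<rho>) \<le> norm \<nu> * norm \<rho> * C"
      by (intro exI[of _ b]) (simp add: ac_simps)
  qed (fact add scale)+
qed

text \<open>The Cauchy-Schwarz argument for the positive semidefinite form, tested against point masses:
  a measure of energy zero has vanishing potential.\<close>

lemma cov_op_eq_0_if_energy_eq_0:
  assumes 0: "energy \<nu> \<nu> = 0" and s: "s \<in> {0..\<tau>}"
  shows "cov_op {0..\<tau>} K \<nu> s = 0"
proof -
  interpret E: bounded_bilinear energy by (rule bounded_bilinear_energy)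
  define c where "c = energy (dirac s) \<nu>"
  define m where "m = energy (dirac s) (dirac s)"
  have ge: "0 \<le> 2 * x * c + x * x * m" for x
    using energy_nonneg[of "\<nu> + x *\<^sub>R dirac s"]
    by (simp add: E.add_left E.add_right E.scaleR_left E.scaleR_right 0 energy_sym[of \<nu> "dirac s"]
        c_def m_def algebra_simps)
  have "m \<ge> 0" unfolding m_def by (rule energy_nonneg)
  have "c = 0"
  proof (rule ccontr)
    assume "c \<noteq> 0"
    \<comment> \<open>a substitute for the minimizer \<open>- c / m\<close> of the quadratic that is also defined for \<open>m = 0\<close>\<close>
    have "0 \<le> 2 * (- c / (m + 1)) * c + (- c / (m + 1)) * (- c / (m + 1)) * m" by (rule ge)
    also have "\<dots> = - (c * c * (m + 2)) / ((m + 1) * (m + 1))"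
      using \<open>m \<ge> 0\<close> by (simp add: divide_simps) (simp add: algebra_simps)
    also have "\<dots> < 0"
    proof -
      have "0 < c * c" using \<open>c \<noteq> 0\<close> by (metis not_real_square_gt_zero)
      then have "0 < (c * c * (m + 2)) / ((m + 1) * (m + 1))"
        using \<open>m \<ge> 0\<close> by (intro divide_pos_pos mult_pos_pos[of "c * c"] mult_pos_pos[of "m + 1"]) auto
      then show ?thesis by simp
    qed
    finally show False by simp
  qed
  then show ?thesis
    using pairing_dirac[OF \<tau> cont_cov_op s, of \<nu>] by (simp add: c_def)
qed

lemma cov_op_diff:
  assumes "s \<in> {0..\<tau>}"
  shows "cov_op {0..\<tau>} K (\<nu> - \<rho>) s = cov_op {0..\<tau>} K \<nu> s - cov_op {0..\<tau>} K \<rho> s"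
  unfolding cov_op_def
  by (rule linear_diff[OF bounded_linear.linear[OF bounded_linear_pairing[OF \<tau> cont_section[OF assms]]]])

end

section \<open>The covariance function of a Gaussian vector\<close>

text \<open>The last identity expresses the variance of a centered normal variable through the expectation
  of a bounded function of it; the degenerate case is included.\<close>

lemma (in prob_space) centered_normal_moments:
  assumes "centered_normal M X"
  shows "integrable M (\<lambda>\<omega>. (X \<omega>)\<^sup>2)" "integrable M X" "expectation X = 0"
    and "expectation (\<lambda>\<omega>. cos (X \<omega>)) = exp (- expectation (\<lambda>\<omega>. (X \<omega>)\<^sup>2) / 2)"
proof -
  have X [measurable]: "X \<in> borel_measurable M"
    and cases: "(AE \<omega> in M. X \<omega> = 0) \<or>
      (\<exists>\<sigma>>0. distributed M lborel X (\<lambda>x. ennreal (normal_density 0 \<sigma> x)))"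
    using assms by (auto simp: centered_normal_def)
  have "integrable M (\<lambda>\<omega>. (X \<omega>)\<^sup>2) \<and> integrable M X \<and> expectation X = 0 \<and>
    expectation (\<lambda>\<omega>. cos (X \<omega>)) = exp (- expectation (\<lambda>\<omega>. (X \<omega>)\<^sup>2) / 2)"
    using cases
  proof
    assume 0: "AE \<omega> in M. X \<omega> = 0"
    have "integrable M (\<lambda>\<omega>. (X \<omega>)\<^sup>2) = integrable M (\<lambda>_. 0::real)" "integrable M X = integrable M (\<lambda>_. 0::real)"
      by (intro integrable_cong_AE; use 0 in auto)+
    moreover have "expectation X = expectation (\<lambda>_. 0)"
      "expectation (\<lambda>\<omega>. (X \<omega>)\<^sup>2) = expectation (\<lambda>_. 0)"
      "expectation (\<lambda>\<omega>. cos (X \<omega>)) = expectation (\<lambda>_. 1)"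
      by (intro integral_cong_AE; use 0 in auto)+
    ultimately show ?thesis by (simp add: prob_space)
  next
    assume "\<exists>\<sigma>>0. distributed M lborel X (\<lambda>x. ennreal (normal_density 0 \<sigma> x))"
    then obtain \<sigma> where \<sigma>: "\<sigma> > 0" and D: "distributed M lborel X (normal_density 0 \<sigma>)" by blast
    have sq: "integrable M (\<lambda>\<omega>. (X \<omega>)\<^sup>2)"
      using distributed_integrable[OF D, of "\<lambda>x. x\<^sup>2"] integrable_normal_moment[OF \<sigma>, of 0 2] by simp
    have int: "integrable M X"
      using distributed_integrable[OF D, of "\<lambda>x. x"] integrable_normal_moment[OF \<sigma>, of 0 1] by simp
    have E: "expectation X = 0" by (rule normal_distributed_expectation[OF \<sigma> D])
    have V: "expectation (\<lambda>\<omega>. (X \<omega>)\<^sup>2) = \<sigma>\<^sup>2"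
      using normal_distributed_variance[OF \<sigma> D] by (simp add: E)
    have std: "distributed M lborel (\<lambda>\<omega>. X \<omega> / \<sigma>) std_normal_density"
      using D normal_standard_normal_convert[OF \<sigma>, of X 0] by simp
    interpret N: prob_space std_normal_distribution
      by (rule real_dist_normal_dist[unfolded real_distribution_def, THEN conjunct1])
    have "expectation (\<lambda>\<omega>. cos (X \<omega>)) = (LINT y|lborel. std_normal_density y * cos (\<sigma> * y))"
      using distributed_integral[OF std, of "\<lambda>y. cos (\<sigma> * y)"] \<sigma> by simp
    also have "\<dots> = (LINT y|std_normal_distribution. cos (\<sigma> * y))"
      by (subst integral_density) auto
    also have "\<dots> = (LINT y|std_normal_distribution. Re (iexp (\<sigma> * y)))"
      by (simp add: Re_exp)
    also have "\<dots> = Re (CLINT y|std_normal_distribution. iexp (\<sigma> * y))"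
      by (rule integral_Re) (rule N.integrable_iexp, auto)
    also have "(CLINT y|std_normal_distribution. iexp (\<sigma> * y)) = char std_normal_distribution \<sigma>"
      by (simp add: char_def)
    finally show ?thesis
      using sq int E by (simp add: V char_std_normal_distribution)
  qed
  then show "integrable M (\<lambda>\<omega>. (X \<omega>)\<^sup>2)" "integrable M X" "expectation X = 0"
    "expectation (\<lambda>\<omega>. cos (X \<omega>)) = exp (- expectation (\<lambda>\<omega>. (X \<omega>)\<^sup>2) / 2)"
    by auto
qed

lemma centered_normal_cong:
  assumes "\<And>\<omega>. \<omega> \<in> space P \<Longrightarrow> X \<omega> = Y \<omega>"
  shows "centered_normal P X \<longleftrightarrow> centered_normal P Y"
proof -
  have "(AE \<omega> in P. X \<omega> = 0) \<longleftrightarrow> (AE \<omega> in P. Y \<omega> = 0)"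
    by (intro AE_cong) (simp add: assms)
  moreover have "X \<in> borel_measurable P \<longleftrightarrow> Y \<in> borel_measurable P"
    by (rule measurable_cong[OF assms])
  moreover have "distr P lborel X = distr P lborel Y"
    by (rule distr_cong) (simp_all add: assms)
  moreover have "X \<in> measurable P lborel \<longleftrightarrow> Y \<in> measurable P lborel"
    by (rule measurable_cong[OF assms])
  ultimately show ?thesis by (simp add: centered_normal_def distributed_def)
qed

text \<open>A centered Gaussian vector in \<open>C[0, \<tau>]\<close> on a probability space, seen as a process with
  continuous paths.\<close>

locale gaussian_process = prob_space P for P :: "'w measure" +
  fixes \<tau> :: real and Z :: "'w \<Rightarrow> real \<Rightarrow> real"
  assumes \<tau>: "\<tau> > 0" and gaussian: "centered_gaussian_vector {0..\<tau>} P Z"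
begin

lemma cont_path:
  assumes "\<omega> \<in> space P"
  shows "continuous_on {0..\<tau>} (Z \<omega>)"
proof -
  have "Z \<in> P \<rightarrow>\<^sub>M borel_C {0..\<tau>}"
    using gaussian by (simp add: centered_gaussian_vector_def)
  moreover have "space (borel_C {0..\<tau>}) = mspace (C_space {0..\<tau>})"
    unfolding borel_C_def
    by (rule space_measure_of) (auto dest!: openin_subset)
  ultimately have "Z \<omega> \<in> mspace (C_space {0..\<tau>})"
    using measurable_space[of Z P "borel_C {0..\<tau>}", OF _ assms] by metis
  then show ?thesis by simp
qed

lemma normal_pairing:
  "\<nu> \<in> signed_measures_on {0..\<tau>} \<Longrightarrow> centered_normal P (\<lambda>\<omega>. pairing {0..\<tau>} \<nu> (Z \<omega>))"
  using gaussian by (simp add: centered_gaussian_vector_def)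

lemma normal_eval:
  assumes s: "s \<in> {0..\<tau>}"
  shows "centered_normal P (\<lambda>\<omega>. Z \<omega> s)"
proof -
  have "centered_normal P (\<lambda>\<omega>. pairing {0..\<tau>} (dirac s) (Z \<omega>))"
    by (intro normal_pairing dirac_in_signed_measures_on s)
  then show ?thesis
    by (rule centered_normal_cong[THEN iffD1, rotated]) (simp add: pairing_dirac[OF \<tau> cont_path s])
qed

lemma normal_increment:
  assumes s: "s \<in> {0..\<tau>}" and u: "u \<in> {0..\<tau>}"
  shows "centered_normal P (\<lambda>\<omega>. Z \<omega> s - Z \<omega> u)"
proof -
  have "dirac s - dirac u \<in> signed_measures_on {0..\<tau>}"
    by (intro subspace_diff signed_measures_on_subspace dirac_in_signed_measures_on s u)
  then have "centered_normal P (\<lambda>\<omega>. pairing {0..\<tau>} (dirac s - dirac u) (Z \<omega>))"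
    by (rule normal_pairing)
  moreover have "pairing {0..\<tau>} (dirac s - dirac u) (Z \<omega>) = Z \<omega> s - Z \<omega> u"
    if \<omega>: "\<omega> \<in> space P" for \<omega>
    using linear_diff[OF bounded_linear.linear[OF bounded_linear_pairing[OF \<tau> cont_path[OF \<omega>]]]]
    by (simp add: pairing_dirac[OF \<tau> cont_path[OF \<omega>] s] pairing_dirac[OF \<tau> cont_path[OF \<omega>] u])
  ultimately show ?thesis
    by (rule centered_normal_cong[THEN iffD1, rotated])
qed

lemma measurable_eval [measurable (raw)]: "s \<in> {0..\<tau>} \<Longrightarrow> (\<lambda>\<omega>. Z \<omega> s) \<in> borel_measurable P"
  using normal_eval by (simp add: centered_normal_def)

lemma integrable_prod:
  assumes s: "s \<in> {0..\<tau>}" and u: "u \<in> {0..\<tau>}"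
  shows "integrable P (\<lambda>\<omega>. Z \<omega> s * Z \<omega> u)"
proof (rule Bochner_Integration.integrable_bound)
  show "integrable P (\<lambda>\<omega>. (Z \<omega> s)\<^sup>2 + (Z \<omega> u)\<^sup>2)"
    by (intro Bochner_Integration.integrable_add centered_normal_moments normal_eval s u)
  have "\<bar>a * b\<bar> \<le> a\<^sup>2 + b\<^sup>2" for a b :: real
    using sum_squares_bound[of a b] sum_squares_bound[of "- a" b] by (simp add: abs_le_iff)
  then show "AE \<omega> in P. norm (Z \<omega> s * Z \<omega> u) \<le> norm ((Z \<omega> s)\<^sup>2 + (Z \<omega> u)\<^sup>2)"
    by auto
qed (use s u in measurable)

lemma cov_fun_eq:
  assumes "s \<in> {0..\<tau>}" "u \<in> {0..\<tau>}"
  shows "cov_fun P Z s u = expectation (\<lambda>\<omega>. Z \<omega> s * Z \<omega> u)"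
  by (simp add: cov_fun_def covariance_def centered_normal_moments(3)[OF normal_eval[OF assms(1)]]
      centered_normal_moments(3)[OF normal_eval[OF assms(2)]])

lemma cov_fun_sym: "cov_fun P Z s u = cov_fun P Z u s"
  by (simp add: cov_fun_def covariance_def mult.commute)

lemma cov_fun_psd:
  fixes n :: nat
  assumes t: "\<And>i. i \<in> {1..n} \<Longrightarrow> t i \<in> {0..\<tau>}"
  shows "0 \<le> (\<Sum>i=1..n. \<Sum>j=1..n. c i * c j * cov_fun P Z (t i) (t j))"
proof -
  have "(\<Sum>i=1..n. \<Sum>j=1..n. c i * c j * cov_fun P Z (t i) (t j))
      = (\<Sum>i=1..n. \<Sum>j=1..n. expectation (\<lambda>\<omega>. c i * c j * (Z \<omega> (t i) * Z \<omega> (t j))))"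
    using t by (intro sum.cong refl) (simp add: cov_fun_eq integrable_prod)
  also have "\<dots> = expectation (\<lambda>\<omega>. \<Sum>i=1..n. \<Sum>j=1..n. c i * c j * (Z \<omega> (t i) * Z \<omega> (t j)))"
    using t by (subst Bochner_Integration.integral_sum;
        (intro Bochner_Integration.integrable_sum integrable_mult_right integrable_prod)?;
        simp add: integrable_prod)
  also have "\<dots> = expectation (\<lambda>\<omega>. (\<Sum>i=1..n. c i * Z \<omega> (t i))\<^sup>2)"
    by (simp add: power2_eq_square sum_product mult_ac)
  also have "0 \<le> \<dots>" by simp
  finally show ?thesis by simp
qed

text \<open>Polarization of the variance, combined with \<open>E cos X = exp (- Var X / 2)\<close>. On the right-hand
  side only expectations of bounded functions of the paths occur, so that continuity of the
  covariance follows from continuity of the paths by dominated convergence; no integrability of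
  \<open>sup |Z|\<^sup>2\<close> is required.\<close>

lemma cov_fun_log_char:
  assumes s: "s \<in> {0..\<tau>}" and u: "u \<in> {0..\<tau>}"
  shows "cov_fun P Z s u = ln (expectation (\<lambda>\<omega>. cos (Z \<omega> s - Z \<omega> u)))
    - ln (expectation (\<lambda>\<omega>. cos (Z \<omega> s))) - ln (expectation (\<lambda>\<omega>. cos (Z \<omega> u)))"
proof -
  have "expectation (\<lambda>\<omega>. (Z \<omega> s - Z \<omega> u)\<^sup>2)
      = expectation (\<lambda>\<omega>. (Z \<omega> s)\<^sup>2 + (Z \<omega> u)\<^sup>2 - 2 * (Z \<omega> s * Z \<omega> u))"
    by (simp add: power2_diff mult.assoc)
  also have "\<dots> = expectation (\<lambda>\<omega>. (Z \<omega> s)\<^sup>2) + expectation (\<lambda>\<omega>. (Z \<omega> u)\<^sup>2)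
      - 2 * expectation (\<lambda>\<omega>. Z \<omega> s * Z \<omega> u)"
    using centered_normal_moments(1)[OF normal_eval[OF s]] centered_normal_moments(1)[OF normal_eval[OF u]]
      integrable_prod[OF s u] by simp
  finally show ?thesis
    by (simp add: cov_fun_eq[OF s u] centered_normal_moments(4)[OF normal_eval[OF s]]
        centered_normal_moments(4)[OF normal_eval[OF u]]
        centered_normal_moments(4)[OF normal_increment[OF s u]] diff_divide_distrib add_divide_distrib)
qed

lemma expectation_cos_pos:
  assumes "centered_normal P X"
  shows "0 < expectation (\<lambda>\<omega>. cos (X \<omega>))"
  by (simp add: centered_normal_moments(4)[OF assms])

lemma continuous_on_expectation_cos:
  fixes S :: "'b::metric_space set"
  assumes X: "\<And>p. p \<in> S \<Longrightarrow> X p \<in> borel_measurable P"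
    and cont: "\<And>\<omega>. \<omega> \<in> space P \<Longrightarrow> continuous_on S (\<lambda>p. X p \<omega> :: real)"
  shows "continuous_on S (\<lambda>p. expectation (\<lambda>\<omega>. cos (X p \<omega>)))"
proof (rule continuous_on_sequentiallyI)
  fix q :: "nat \<Rightarrow> 'b" and p assume q: "\<forall>n. q n \<in> S" "q \<longlonglongrightarrow> p" and p: "p \<in> S"
  show "(\<lambda>n. expectation (\<lambda>\<omega>. cos (X (q n) \<omega>))) \<longlonglongrightarrow> expectation (\<lambda>\<omega>. cos (X p \<omega>))"
  proof (rule integral_dominated_convergence[where w="\<lambda>_. 1"])
    show "AE \<omega> in P. (\<lambda>n. cos (X (q n) \<omega>)) \<longlonglongrightarrow> cos (X p \<omega>)"
    proof (rule AE_I2)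
      fix \<omega> assume "\<omega> \<in> space P"
      then have "(\<lambda>n. X (q n) \<omega>) \<longlonglongrightarrow> X p \<omega>"
        using cont p q unfolding continuous_on_sequentially o_def by blast
      then show "(\<lambda>n. cos (X (q n) \<omega>)) \<longlonglongrightarrow> cos (X p \<omega>)" by (rule tendsto_cos)
    qed
    show "(\<lambda>\<omega>. cos (X p \<omega>)) \<in> borel_measurable P" "\<And>n. (\<lambda>\<omega>. cos (X (q n) \<omega>)) \<in> borel_measurable P"
      using X p q(1) by (auto intro!: measurable_compose[OF _ borel_measurable_cos])
  qed auto
qed

lemma cov_fun_cont: "continuous_on ({0..\<tau>} \<times> {0..\<tau>}) (\<lambda>p. cov_fun P Z (fst p) (snd p))"
proof -
  let ?S = "{0..\<tau>} \<times> {0..\<tau>}"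
  have Z: "continuous_on ?S (\<lambda>p. Z \<omega> (fst p))" "continuous_on ?S (\<lambda>p. Z \<omega> (snd p))"
    if "\<omega> \<in> space P" for \<omega>
    by (intro continuous_on_compose2[OF cont_path[OF that]] continuous_intros; auto)+
  have "continuous_on ?S (\<lambda>p. ln (expectation (\<lambda>\<omega>. cos (Z \<omega> (fst p) - Z \<omega> (snd p))))
    - ln (expectation (\<lambda>\<omega>. cos (Z \<omega> (fst p)))) - ln (expectation (\<lambda>\<omega>. cos (Z \<omega> (snd p)))))"
  proof (intro continuous_on_diff continuous_on_ln continuous_on_expectation_cos ballI)
    fix p assume p: "p \<in> ?S"
    then have p': "fst p \<in> {0..\<tau>}" "snd p \<in> {0..\<tau>}" by auto
    show "expectation (\<lambda>\<omega>. cos (Z \<omega> (fst p) - Z \<omega> (snd p))) \<noteq> 0"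
      "expectation (\<lambda>\<omega>. cos (Z \<omega> (fst p))) \<noteq> 0" "expectation (\<lambda>\<omega>. cos (Z \<omega> (snd p))) \<noteq> 0"
      using expectation_cos_pos[OF normal_increment[OF p']] expectation_cos_pos[OF normal_eval[OF p'(1)]]
        expectation_cos_pos[OF normal_eval[OF p'(2)]] by auto
    show "(\<lambda>\<omega>. Z \<omega> (fst p) - Z \<omega> (snd p)) \<in> borel_measurable P"
      "(\<lambda>\<omega>. Z \<omega> (fst p)) \<in> borel_measurable P" "(\<lambda>\<omega>. Z \<omega> (snd p)) \<in> borel_measurable P"
      using p' by (auto intro!: borel_measurable_diff measurable_eval simp del: atLeastAtMost_iff)
  qed (use Z in \<open>auto intro!: continuous_on_diff\<close>)
  then show ?thesis
    by (rule continuous_on_eq) (auto simp: cov_fun_log_char)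
qed

end


section \<open>Maximizers of a perturbed quadratic contrast\<close>

text \<open>An invertible linear equation with a residual that is small relative to \<open>1 + |w|\<close>; the
  boundedness of the solutions \<open>w\<close> is part of the conclusion, not of the hypothesis.\<close>

lemma tendsto_matrix_inv:
  fixes M :: "real^'n^'n" and w :: "nat \<Rightarrow> real^'n"
  assumes M: "invertible M" and \<eta>: "\<eta> \<longlonglongrightarrow> 0"
    and le: "\<forall>\<^sub>F k in sequentially. norm (M *v w k - c) \<le> \<eta> k * (1 + norm (w k))"
  shows "w \<longlonglongrightarrow> matrix_inv M *v c"
proof -
  define u where "u = matrix_inv M *v c"
  obtain C where C: "C > 0" "\<And>x. norm (matrix_inv M *v x) \<le> norm x * C"
    using bounded_linear.pos_bounded[OF matrix_vector_mul_bounded_linear[of "matrix_inv M"]] by blast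
  have inv: "matrix_inv M ** M = mat 1"
    using someI_ex[OF M[unfolded invertible_def]] unfolding matrix_inv_def by simp
  have diff: "w k - u = matrix_inv M *v (M *v w k - c)" for k
    unfolding u_def matrix_vector_mult_diff_distrib matrix_vector_mul_assoc inv by simp
  have "(\<lambda>k. C * \<eta> k) \<longlonglongrightarrow> C * 0" "(\<lambda>k. 2 * C * \<eta> k * (1 + norm u)) \<longlonglongrightarrow> 2 * C * 0 * (1 + norm u)"
    by (intro tendsto_intros \<eta>)+
  then have lim: "(\<lambda>k. C * \<eta> k) \<longlonglongrightarrow> 0" "(\<lambda>k. 2 * C * \<eta> k * (1 + norm u)) \<longlonglongrightarrow> 0"
    by simp_all
  have "\<forall>\<^sub>F k in sequentially. C * \<eta> k < 1/2"
    using lim(1) by (rule order_tendstoD) simp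
  with le have "\<forall>\<^sub>F k in sequentially. norm (w k - u) \<le> 2 * C * \<eta> k * (1 + norm u)"
  proof eventually_elim
    case (elim k)
    have "0 \<le> \<eta> k * (1 + norm (w k))"
      using elim(1) norm_ge_zero order_trans by blast
    then have "0 \<le> \<eta> k"
      by (simp add: zero_le_mult_iff add_pos_nonneg not_le) (smt (verit) norm_ge_zero)
    have "norm (w k - u) \<le> norm (M *v w k - c) * C"
      unfolding diff by (rule C)
    also have "\<dots> \<le> \<eta> k * (1 + norm (w k)) * C"
      using elim(1) C(1) by (intro mult_right_mono) auto
    also have "\<dots> \<le> \<eta> k * (1 + (norm u + norm (w k - u))) * C"
      using C(1) \<open>0 \<le> \<eta> k\<close> norm_triangle_sub[of "w k" u]
      by (intro mult_right_mono mult_left_mono) auto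
    also have "\<dots> = C * \<eta> k * (1 + norm u) + C * \<eta> k * norm (w k - u)"
      by (simp add: algebra_simps)
    also have "\<dots> \<le> C * \<eta> k * (1 + norm u) + 1/2 * norm (w k - u)"
      using elim(2) by (intro add_left_mono mult_right_mono) auto
    finally show ?case by simp
  qed
  then have "(\<lambda>k. w k - u) \<longlonglongrightarrow> 0"
    by (rule Lim_null_comparison[OF _ lim(2)])
  then show ?thesis
    unfolding u_def[symmetric] by (simp add: LIM_zero_iff)
qed

text \<open>A deterministic argmax problem in a normed space. The target of the approximation is the contrast
  \<open>B (\<mu> \<theta>) (\<mu> \<theta>\<^sub>0) + \<epsilon> l (\<mu> \<theta>) - B (\<mu> \<theta>) (\<mu> \<theta>) / 2\<close>, in which \<open>B\<close>, \<open>l\<close> and the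
  linear form \<open>\<nu> \<mapsto> B \<nu> (\<mu> \<theta>\<^sub>0)\<close> are replaced by \<open>b\<^sub>n\<close>, \<open>l\<^sub>n\<close> and \<open>a\<^sub>n\<close>. The parts that
  carry no factor \<open>\<epsilon>\<close> are approximated up to \<open>r = o(\<epsilon>)\<close> in operator norm, whereas \<open>l\<^sub>n\<close> need only
  converge to \<open>l\<close> in operator norm, at no particular rate. The sequence \<open>\<theta>\<^sub>n\<close> consists of maximizers over \<open>\<Theta>\<close>.\<close>

locale perturbed_contrast =
  fixes \<Theta> :: "(real^'p) set" and \<theta>\<^sub>0 :: "real^'p" and \<mu> :: "real^'p \<Rightarrow> 'e::real_normed_vector"
    and B :: "'e \<Rightarrow> 'e \<Rightarrow> real" and l :: "'e \<Rightarrow> real"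
    and a\<^sub>n :: "nat \<Rightarrow> 'e \<Rightarrow> real" and b\<^sub>n :: "nat \<Rightarrow> 'e \<Rightarrow> 'e \<Rightarrow> real" and l\<^sub>n :: "nat \<Rightarrow> 'e \<Rightarrow> real"
    and \<epsilon> r s :: "nat \<Rightarrow> real" and \<theta>\<^sub>n :: "nat \<Rightarrow> real^'p"
  assumes compact: "compact \<Theta>" and interior: "\<theta>\<^sub>0 \<in> interior \<Theta>"
    and \<mu>_cont: "continuous_on \<Theta> \<mu>"
    and \<mu>_diff: "\<And>x. x \<in> interior \<Theta> \<Longrightarrow> \<mu> differentiable (at x)"
    and d_cont: "\<And>i. continuous_on (interior \<Theta>) (partial_deriv \<mu> i)"
    and B: "bounded_bilinear B" "\<And>\<nu> \<rho>. B \<nu> \<rho> = B \<rho> \<nu>" "\<And>\<nu>. 0 \<le> B \<nu> \<nu>"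
    and identifiable: "\<And>\<theta>. \<theta> \<in> \<Theta> \<Longrightarrow> B (\<mu> \<theta> - \<mu> \<theta>\<^sub>0) (\<mu> \<theta> - \<mu> \<theta>\<^sub>0) = 0 \<Longrightarrow> \<theta> = \<theta>\<^sub>0"
    and l: "bounded_linear l"
    and linear_n: "\<And>k. bounded_linear (a\<^sub>n k)" "\<And>k. bounded_linear (l\<^sub>n k)"
    and b_n: "\<And>k. bounded_bilinear (b\<^sub>n k)" "\<And>k \<nu> \<rho>. b\<^sub>n k \<nu> \<rho> = b\<^sub>n k \<rho> \<nu>"
    and a_err: "\<forall>\<^sub>F k in sequentially. \<forall>\<nu>. \<bar>a\<^sub>n k \<nu> - B \<nu> (\<mu> \<theta>\<^sub>0)\<bar> \<le> r k * norm \<nu>"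
    and b_err: "\<forall>\<^sub>F k in sequentially. \<forall>\<nu> \<rho>. \<bar>b\<^sub>n k \<nu> \<rho> - B \<nu> \<rho>\<bar> \<le> r k * norm \<nu> * norm \<rho>"
    and l_err: "\<forall>\<^sub>F k in sequentially. \<forall>\<nu>. \<bar>l\<^sub>n k \<nu> - l \<nu>\<bar> \<le> s k * norm \<nu>"
    and \<epsilon>: "\<And>k. \<epsilon> k > 0" "\<epsilon> \<longlonglongrightarrow> 0"
    and r: "(\<lambda>k. r k / \<epsilon> k) \<longlonglongrightarrow> 0" and s: "s \<longlonglongrightarrow> 0"
    and maximizer: "\<And>k. is_arg_max (\<lambda>\<theta>. a\<^sub>n k (\<mu> \<theta>) + \<epsilon> k * l\<^sub>n k (\<mu> \<theta>) - b\<^sub>n k (\<mu> \<theta>) (\<mu> \<theta>) / 2)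
      (\<lambda>\<theta>. \<theta> \<in> \<Theta>) (\<theta>\<^sub>n k)"
begin

lemma \<theta>_n_in: "\<theta>\<^sub>n k \<in> \<Theta>"
  using maximizer[of k] by (simp add: is_arg_max_def)

lemma maximizer_ge:
  "\<theta> \<in> \<Theta> \<Longrightarrow> a\<^sub>n k (\<mu> \<theta>) + \<epsilon> k * l\<^sub>n k (\<mu> \<theta>) - b\<^sub>n k (\<mu> \<theta>) (\<mu> \<theta>) / 2
    \<le> a\<^sub>n k (\<mu> (\<theta>\<^sub>n k)) + \<epsilon> k * l\<^sub>n k (\<mu> (\<theta>\<^sub>n k)) - b\<^sub>n k (\<mu> (\<theta>\<^sub>n k)) (\<mu> (\<theta>\<^sub>n k)) / 2"
  using maximizer[of k] by (auto simp: is_arg_max_def not_less)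

lemma r_tendsto_0: "r \<longlonglongrightarrow> 0"
proof -
  have "(\<lambda>k. r k / \<epsilon> k * \<epsilon> k) \<longlonglongrightarrow> 0 * 0"
    by (intro tendsto_mult r \<epsilon>)
  moreover have "r k / \<epsilon> k * \<epsilon> k = r k" for k
    using \<epsilon>(1)[of k] by simp
  ultimately show ?thesis by simp
qed

text \<open>Up to a constant, the contrast is uniformly close on \<open>\<Theta>\<close> to minus half of the squared
  \<open>B\<close>-distance between \<open>\<mu> \<theta>\<close> and \<open>\<mu> \<theta>\<^sub>0\<close>, so a maximizer has a small distance.\<close>

lemma distance_tendsto_0:
  "(\<lambda>k. B (\<mu> (\<theta>\<^sub>n k) - \<mu> \<theta>\<^sub>0) (\<mu> (\<theta>\<^sub>n k) - \<mu> \<theta>\<^sub>0)) \<longlonglongrightarrow> 0"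
proof -
  interpret B: bounded_bilinear B by (rule B)
  have "bounded (\<mu> ` \<Theta>)"
    by (intro compact_imp_bounded compact_continuous_image \<mu>_cont compact)
  then obtain M where M: "M > 0" "\<And>\<theta>. \<theta> \<in> \<Theta> \<Longrightarrow> norm (\<mu> \<theta>) \<le> M"
    by (auto simp: bounded_pos)
  obtain C where C: "C > 0" "\<And>\<nu>. \<bar>l \<nu>\<bar> \<le> norm \<nu> * C"
    using bounded_linear.pos_bounded[OF l] by auto
  define \<Psi> where "\<Psi> \<theta> = B (\<mu> \<theta>) (\<mu> \<theta>\<^sub>0) - B (\<mu> \<theta>) (\<mu> \<theta>) / 2" for \<theta>
  define \<eta> where "\<eta> k = \<bar>r k\<bar> * M + \<epsilon> k * (\<bar>s k\<bar> * M + M * C) + \<bar>r k\<bar> * M * M / 2" for k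
  have \<Psi>: "B (\<mu> \<theta> - \<mu> \<theta>\<^sub>0) (\<mu> \<theta> - \<mu> \<theta>\<^sub>0) = 2 * (\<Psi> \<theta>\<^sub>0 - \<Psi> \<theta>)" for \<theta>
    by (simp add: \<Psi>_def B.diff_left B.diff_right B(2)[of "\<mu> \<theta>\<^sub>0" "\<mu> \<theta>"] algebra_simps)
  have near: "\<forall>\<^sub>F k in sequentially. \<forall>\<theta>\<in>\<Theta>.
      \<bar>a\<^sub>n k (\<mu> \<theta>) + \<epsilon> k * l\<^sub>n k (\<mu> \<theta>) - b\<^sub>n k (\<mu> \<theta>) (\<mu> \<theta>) / 2 - \<Psi> \<theta>\<bar> \<le> \<eta> k"
    using a_err b_err l_err
  proof eventually_elim
    case (elim k)
    show ?case
    proof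
      fix \<theta> assume \<theta>: "\<theta> \<in> \<Theta>"
      let ?m = "\<mu> \<theta>"
      have m: "norm ?m \<le> M" "0 \<le> norm ?m" using M \<theta> by auto
      have "\<bar>a\<^sub>n k ?m - B ?m (\<mu> \<theta>\<^sub>0)\<bar> \<le> \<bar>r k\<bar> * M"
        using elim(1)[rule_format, of ?m] m
        by (meson abs_ge_self abs_ge_zero mult_mono order_trans)
      moreover have "\<bar>b\<^sub>n k ?m ?m - B ?m ?m\<bar> \<le> \<bar>r k\<bar> * M * M"
      proof -
        have "r k * norm ?m * norm ?m \<le> \<bar>r k\<bar> * M * M"
          using m M(1) by (intro mult_mono) auto
        with elim(2)[rule_format, of ?m ?m] show ?thesis by linarith
      qed
      moreover have "\<bar>\<epsilon> k * l\<^sub>n k ?m\<bar> \<le> \<epsilon> k * (\<bar>s k\<bar> * M + M * C)"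
      proof -
        have "s k * norm ?m \<le> \<bar>s k\<bar> * M" "norm ?m * C \<le> M * C"
          using m C(1) by (auto intro!: mult_mono)
        then have "\<bar>l\<^sub>n k ?m\<bar> \<le> \<bar>s k\<bar> * M + M * C"
          using elim(3)[rule_format, of ?m] C(2)[of ?m] by linarith
        then show ?thesis using \<epsilon>(1)[of k] by (simp add: abs_mult)
      qed
      ultimately show "\<bar>a\<^sub>n k ?m + \<epsilon> k * l\<^sub>n k ?m - b\<^sub>n k ?m ?m / 2 - \<Psi> \<theta>\<bar> \<le> \<eta> k"
        unfolding \<Psi>_def \<eta>_def by argo
    qed
  qed
  have \<eta>: "(\<lambda>k. 4 * \<eta> k) \<longlonglongrightarrow> 0"
  proof -
    have "(\<lambda>k. 4 * \<eta> k) \<longlonglongrightarrow> 4 * (\<bar>0\<bar> * M + 0 * (\<bar>0\<bar> * M + M * C) + \<bar>0\<bar> * M * M / 2)"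
      unfolding \<eta>_def by (intro tendsto_intros r_tendsto_0 s \<epsilon>) simp
    then show ?thesis by simp
  qed
  show ?thesis
  proof (rule Lim_null_comparison[OF _ \<eta>])
    show "\<forall>\<^sub>F k in sequentially.
        norm (B (\<mu> (\<theta>\<^sub>n k) - \<mu> \<theta>\<^sub>0) (\<mu> (\<theta>\<^sub>n k) - \<mu> \<theta>\<^sub>0)) \<le> 4 * \<eta> k"
      using near
    proof eventually_elim
      case (elim k)
      have in0: "\<theta>\<^sub>0 \<in> \<Theta>" using interior interior_subset by blast
      show ?case
        using elim[rule_format, OF in0] elim[rule_format, OF \<theta>_n_in[of k]]
          maximizer_ge[OF in0, of k] B(3)[of "\<mu> (\<theta>\<^sub>n k) - \<mu> \<theta>\<^sub>0"]
        unfolding \<Psi> by (simp add: abs_le_iff)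
    qed
  qed
qed

text \<open>Outside a ball about \<open>\<theta>\<^sub>0\<close> the \<open>B\<close>-distance is bounded away from zero, by compactness and
  identifiability.\<close>

lemma consistent: "\<theta>\<^sub>n \<longlonglongrightarrow> \<theta>\<^sub>0"
proof (rule tendstoI)
  fix e :: real assume e: "e > 0"
  let ?J = "\<lambda>\<theta>. B (\<mu> \<theta> - \<mu> \<theta>\<^sub>0) (\<mu> \<theta> - \<mu> \<theta>\<^sub>0)"
  have cp: "compact (\<Theta> - ball \<theta>\<^sub>0 e)"
    by (intro compact_diff compact) simp
  have ct: "continuous_on (\<Theta> - ball \<theta>\<^sub>0 e) ?J"
    by (intro bounded_bilinear.continuous_on[OF B(1)] continuous_intros
        continuous_on_subset[OF \<mu>_cont]) auto
  show "\<forall>\<^sub>F k in sequentially. dist (\<theta>\<^sub>n k) \<theta>\<^sub>0 < e"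
  proof (cases "\<Theta> - ball \<theta>\<^sub>0 e = {}")
    case True
    then have "\<theta>\<^sub>n k \<in> ball \<theta>\<^sub>0 e" for k using \<theta>_n_in[of k] by blast
    then show ?thesis by (simp add: dist_commute)
  next
    case False
    then obtain \<theta>\<^sub>1 where 1: "\<theta>\<^sub>1 \<in> \<Theta> - ball \<theta>\<^sub>0 e" "\<And>\<theta>. \<theta> \<in> \<Theta> - ball \<theta>\<^sub>0 e \<Longrightarrow> ?J \<theta>\<^sub>1 \<le> ?J \<theta>"
      using continuous_attains_inf[OF cp _ ct] by blast
    have "?J \<theta>\<^sub>1 \<noteq> 0"
      using identifiable[of \<theta>\<^sub>1] 1(1) e by auto
    with B(3)[of "\<mu> \<theta>\<^sub>1 - \<mu> \<theta>\<^sub>0"] have "?J \<theta>\<^sub>1 > 0" by simp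
    with distance_tendsto_0 have "\<forall>\<^sub>F k in sequentially. ?J (\<theta>\<^sub>n k) < ?J \<theta>\<^sub>1"
      by (rule order_tendstoD)
    then show ?thesis
    proof eventually_elim
      case (elim k)
      then have "\<theta>\<^sub>n k \<notin> \<Theta> - ball \<theta>\<^sub>0 e" using 1(2)[of "\<theta>\<^sub>n k"] by linarith
      then show ?case using \<theta>_n_in[of k] by (simp add: dist_commute)
    qed
  qed
qed

lemma eventually_interior: "\<forall>\<^sub>F k in sequentially. \<theta>\<^sub>n k \<in> interior \<Theta>"
  by (rule topological_tendstoD[OF consistent open_interior interior])

lemma first_order_condition:
  assumes k: "\<theta>\<^sub>n k \<in> interior \<Theta>"
  shows "a\<^sub>n k (partial_deriv \<mu> i (\<theta>\<^sub>n k)) + \<epsilon> k * l\<^sub>n k (partial_deriv \<mu> i (\<theta>\<^sub>n k))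
    = b\<^sub>n k (partial_deriv \<mu> i (\<theta>\<^sub>n k)) (\<mu> (\<theta>\<^sub>n k))"
proof -
  let ?x = "\<theta>\<^sub>n k"
  let ?D = "frechet_derivative \<mu> (at ?x)"
  have D: "(\<mu> has_derivative ?D) (at ?x)"
    using \<mu>_diff[OF k] by (simp add: frechet_derivative_works)
  have "((\<lambda>\<theta>. a\<^sub>n k (\<mu> \<theta>) + \<epsilon> k * l\<^sub>n k (\<mu> \<theta>) - b\<^sub>n k (\<mu> \<theta>) (\<mu> \<theta>) / 2) has_derivative
      (\<lambda>h. a\<^sub>n k (?D h) + \<epsilon> k * l\<^sub>n k (?D h) - (b\<^sub>n k (\<mu> ?x) (?D h) + b\<^sub>n k (?D h) (\<mu> ?x)) / 2)) (at ?x)"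
    by (intro has_derivative_add has_derivative_diff has_derivative_mult_right
        bounded_linear.has_derivative[OF bounded_linear_divide] bounded_linear.has_derivative[OF linear_n(1) D]
        bounded_linear.has_derivative[OF linear_n(2) D] bounded_bilinear.FDERIV[OF b_n(1) D D])
  from differential_zero_maxmin[OF k open_interior this]
  have "(\<lambda>h. a\<^sub>n k (?D h) + \<epsilon> k * l\<^sub>n k (?D h) - (b\<^sub>n k (\<mu> ?x) (?D h) + b\<^sub>n k (?D h) (\<mu> ?x)) / 2) = (\<lambda>h. 0)"
    using maximizer_ge interior_subset by blast
  from fun_cong[OF this, of "axis i 1"] show ?thesis
    by (simp add: partial_deriv_def b_n(2)[of k "\<mu> ?x"])
qed

lemma frechet_partial_deriv:
  assumes "x \<in> interior \<Theta>"
  shows "frechet_derivative \<mu> (at x) v = (\<Sum>j\<in>UNIV. v $ j *\<^sub>R partial_deriv \<mu> j x)"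
proof -
  interpret D: bounded_linear "frechet_derivative \<mu> (at x)"
    using \<mu>_diff[OF assms] by (simp add: frechet_derivative_works has_derivative_bounded_linear)
  have "frechet_derivative \<mu> (at x) v = frechet_derivative \<mu> (at x) (\<Sum>j\<in>UNIV. v $ j *\<^sub>R axis j 1)"
    by (simp add: basis_expansion scalar_mult_eq_scaleR[symmetric])
  then show ?thesis by (simp add: D.sum D.scaleR partial_deriv_def)
qed

text \<open>The Gram matrix of the partial derivatives of \<open>\<mu>\<close> at \<open>\<theta>\<^sub>0\<close> with respect to \<open>B\<close>.\<close>

definition information :: "real^'p^'p" where
  "information = (\<chi> i j. B (partial_deriv \<mu> i \<theta>\<^sub>0) (partial_deriv \<mu> j \<theta>\<^sub>0))"

text \<open>The first order condition divided by \<open>\<epsilon>\<close> and linearized at \<open>\<theta>\<^sub>0\<close>: the normalized deviation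
  \<open>w\<close> satisfies \<open>information w = l (\<partial>\<mu> \<theta>\<^sub>0) + o(1 + |w|)\<close>. Boundedness of \<open>w\<close> is not known at this
  point, hence the factor \<open>1 + |w|\<close>. Only first derivatives of \<open>\<mu>\<close> enter.\<close>

lemma linearized_score:
  "\<exists>\<eta>. \<eta> \<longlonglongrightarrow> 0 \<and> (\<forall>\<^sub>F k in sequentially.
     \<bar>(information *v ((1 / \<epsilon> k) *\<^sub>R (\<theta>\<^sub>n k - \<theta>\<^sub>0))) $ i - l (partial_deriv \<mu> i \<theta>\<^sub>0)\<bar>
       \<le> \<eta> k * (1 + norm ((1 / \<epsilon> k) *\<^sub>R (\<theta>\<^sub>n k - \<theta>\<^sub>0))))"
proof -
  interpret B: bounded_bilinear B by (rule B)
  interpret l: bounded_linear l by (rule l)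
  define D where "D = frechet_derivative \<mu> (at \<theta>\<^sub>0)"
  have D: "(\<mu> has_derivative D) (at \<theta>\<^sub>0)"
    using \<mu>_diff[OF interior] by (simp add: D_def frechet_derivative_works)
  interpret D: bounded_linear D using D by (rule has_derivative_bounded_linear)
  obtain C where C: "C > 0" "\<And>\<nu> \<rho>. \<bar>B \<nu> \<rho>\<bar> \<le> norm \<nu> * norm \<rho> * C"
    using B.pos_bounded by auto
  obtain C' where C': "C' > 0" "\<And>v. norm (D v) \<le> norm v * C'"
    using D.pos_bounded by auto
  define d where "d k = partial_deriv \<mu> i (\<theta>\<^sub>n k)" for k
  define d0 where "d0 = partial_deriv \<mu> i \<theta>\<^sub>0"
  define v where "v k = \<theta>\<^sub>n k - \<theta>\<^sub>0" for k
  define rem where "rem k = \<mu> (\<theta>\<^sub>n k) - \<mu> \<theta>\<^sub>0 - D (v k)" for k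
  define q where "q k = norm (rem k) / norm (v k)" for k
  have v0: "v \<longlonglongrightarrow> 0"
    unfolding v_def using consistent by (simp add: LIM_zero)
  have d: "d \<longlonglongrightarrow> d0"
  proof -
    have "isCont (partial_deriv \<mu> i) \<theta>\<^sub>0"
      using d_cont[of i] interior by (simp add: continuous_on_eq_continuous_at)
    then show ?thesis
      unfolding d_def d0_def by (rule isCont_tendsto_compose[OF _ consistent])
  qed
  have m: "(\<lambda>k. \<mu> (\<theta>\<^sub>n k)) \<longlonglongrightarrow> \<mu> \<theta>\<^sub>0"
    using \<mu>_cont interior consistent
    by (intro isCont_tendsto_compose[of _ \<mu>]) (simp_all add: continuous_on_interior)
  have q: "q \<longlonglongrightarrow> 0"
  proof (rule tendstoI)
    fix e :: real assume e: "e > 0"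
    then have "e / 2 > 0" by simp
    then obtain \<delta> where \<delta>: "\<delta> > 0" "\<And>y. norm (y - \<theta>\<^sub>0) < \<delta> \<Longrightarrow>
        norm (\<mu> y - \<mu> \<theta>\<^sub>0 - D (y - \<theta>\<^sub>0)) \<le> e / 2 * norm (y - \<theta>\<^sub>0)"
      using D unfolding has_derivative_at_alt by blast
    have "\<forall>\<^sub>F k in sequentially. norm (v k) < \<delta>"
      using tendstoD[OF v0 \<delta>(1)] by simp
    then show "\<forall>\<^sub>F k in sequentially. dist (q k) 0 < e"
    proof eventually_elim
      case (elim k)
      from \<delta>(2)[of "\<theta>\<^sub>n k"] elim have "norm (rem k) \<le> e / 2 * norm (v k)"
        by (simp add: rem_def v_def)
      then have "q k \<le> e / 2"
        using e by (cases "v k = 0") (simp_all add: q_def field_simps)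
      moreover have "0 \<le> q k" by (simp add: q_def)
      ultimately show ?case using e by simp
    qed
  qed
  have rem: "norm (rem k) = q k * norm (v k)" for k
    by (cases "v k = 0") (auto simp: q_def rem_def v_def D.zero)
  \<comment> \<open>\<open>\<alpha>\<close> collects the absolute errors, \<open>\<beta>\<close> those proportional to the deviation\<close>
  define \<alpha> where "\<alpha> k = r k / \<epsilon> k * norm (d k) * (norm (\<mu> (\<theta>\<^sub>n k)) + 1)
    + (s k * norm (d k) + \<bar>l (d k) - l d0\<bar>)" for k
  define \<beta> where "\<beta> k = norm (d k) * q k * C + norm (d k - d0) * C' * C" for k
  have "\<alpha> \<longlonglongrightarrow> 0 * norm d0 * (norm (\<mu> \<theta>\<^sub>0) + 1) + (0 * norm d0 + \<bar>l d0 - l d0\<bar>)"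
    unfolding \<alpha>_def by (intro tendsto_intros d m r s l.tendsto)
  moreover have "\<beta> \<longlonglongrightarrow> norm d0 * 0 * C + norm (d0 - d0) * C' * C"
    unfolding \<beta>_def by (intro tendsto_intros d q)
  ultimately have "(\<lambda>k. \<bar>\<alpha> k\<bar> + \<bar>\<beta> k\<bar>) \<longlonglongrightarrow> \<bar>0\<bar> + \<bar>0\<bar>"
    by (intro tendsto_intros) simp_all
  then have lim: "(\<lambda>k. \<bar>\<alpha> k\<bar> + \<bar>\<beta> k\<bar>) \<longlonglongrightarrow> 0" by simp
  have "\<forall>\<^sub>F k in sequentially. \<bar>(information *v ((1 / \<epsilon> k) *\<^sub>R v k)) $ i - l d0\<bar>
       \<le> (\<bar>\<alpha> k\<bar> + \<bar>\<beta> k\<bar>) * (1 + norm ((1 / \<epsilon> k) *\<^sub>R v k))"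
    using a_err b_err l_err eventually_interior
  proof eventually_elim
    case (elim k)
    have e: "\<epsilon> k > 0" by (rule \<epsilon>)
    let ?m = "\<mu> (\<theta>\<^sub>n k)"
    have info: "(information *v u) $ i = B d0 (D u)" for u
      by (simp add: D_def frechet_partial_deriv[OF interior] B.sum_right B.scaleR_right
          matrix_vector_mult_def information_def d0_def mult.commute)
    have "(information *v ((1 / \<epsilon> k) *\<^sub>R v k)) $ i - l d0 = (B d0 (D (v k)) - \<epsilon> k * l d0) / \<epsilon> k"
      using e by (simp add: info D.scaleR B.scaleR_right field_simps)
    \<comment> \<open>exchange \<open>d0\<close> for \<open>d k\<close> and \<open>D (v k)\<close> for the increment of \<open>\<mu>\<close>, then apply the first order condition\<close>
    moreover have "B d0 (D (v k)) - \<epsilon> k * l d0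
       = (B (d k) ?m - b\<^sub>n k (d k) ?m) + (a\<^sub>n k (d k) - B (d k) (\<mu> \<theta>\<^sub>0))
         + \<epsilon> k * (l\<^sub>n k (d k) - l (d k)) + \<epsilon> k * (l (d k) - l d0)
         - B (d k) (rem k) - B (d k - d0) (D (v k))"
      using first_order_condition[OF elim(4), of i, folded d_def]
      by (simp add: rem_def B.diff_left B.diff_right B.add_right algebra_simps)
    moreover have "\<bar>B (d k) ?m - b\<^sub>n k (d k) ?m\<bar> \<le> r k * norm (d k) * norm ?m"
      using elim(2)[rule_format, of "d k" ?m] by (simp add: abs_minus_commute)
    moreover have "\<bar>a\<^sub>n k (d k) - B (d k) (\<mu> \<theta>\<^sub>0)\<bar> \<le> r k * norm (d k)"
      using elim(1) by blast
    moreover have "\<bar>\<epsilon> k * (l\<^sub>n k (d k) - l (d k))\<bar> \<le> \<epsilon> k * (s k * norm (d k))"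
      using elim(3) e by (simp add: abs_mult)
    moreover have "\<bar>\<epsilon> k * (l (d k) - l d0)\<bar> = \<epsilon> k * \<bar>l (d k) - l d0\<bar>"
      using e by (simp add: abs_mult)
    moreover have "\<bar>B (d k) (rem k)\<bar> \<le> norm (d k) * q k * C * norm (v k)"
      using C(2)[of "d k" "rem k"] by (simp add: rem ac_simps)
    moreover have "\<bar>B (d k - d0) (D (v k))\<bar> \<le> norm (d k - d0) * C' * C * norm (v k)"
    proof -
      have "norm (d k - d0) * norm (D (v k)) * C \<le> norm (d k - d0) * (norm (v k) * C') * C"
        using C(1) C'(2) by (intro mult_right_mono mult_left_mono) auto
      with C(2)[of "d k - d0" "D (v k)"] show ?thesis by (simp add: ac_simps)
    qed
    ultimately have "\<bar>(information *v ((1 / \<epsilon> k) *\<^sub>R v k)) $ i - l d0\<bar>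
      \<le> (r k * norm (d k) * norm ?m + r k * norm (d k) + \<epsilon> k * (s k * norm (d k))
        + \<epsilon> k * \<bar>l (d k) - l d0\<bar> + norm (d k) * q k * C * norm (v k)
        + norm (d k - d0) * C' * C * norm (v k)) / \<epsilon> k"
      using e by (simp add: divide_right_mono)
    also have "\<dots> = \<alpha> k + \<beta> k * norm ((1 / \<epsilon> k) *\<^sub>R v k)"
      using e by (simp add: \<alpha>_def \<beta>_def field_simps)
    also have "\<dots> \<le> \<bar>\<alpha> k\<bar> + \<bar>\<beta> k\<bar> * norm ((1 / \<epsilon> k) *\<^sub>R v k)"
      by (intro add_mono mult_right_mono) auto
    also have "\<dots> \<le> (\<bar>\<alpha> k\<bar> + \<bar>\<beta> k\<bar>) * (1 + norm ((1 / \<epsilon> k) *\<^sub>R v k))"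
      using mult_nonneg_nonneg[of "\<bar>\<alpha> k\<bar>" "norm ((1 / \<epsilon> k) *\<^sub>R v k)"]
      unfolding distrib_left distrib_right mult_1_right
      by (smt (verit) abs_ge_zero norm_ge_zero)
    finally show ?case .
  qed
  with lim show ?thesis unfolding v_def d0_def by blast
qed

theorem maximizer_expansion:
  assumes "invertible information"
  shows "(\<lambda>k. (1 / \<epsilon> k) *\<^sub>R (\<theta>\<^sub>n k - \<theta>\<^sub>0)) \<longlonglongrightarrow>
    matrix_inv information *v (\<chi> i. l (partial_deriv \<mu> i \<theta>\<^sub>0))"
proof -
  let ?w = "\<lambda>k. (1 / \<epsilon> k) *\<^sub>R (\<theta>\<^sub>n k - \<theta>\<^sub>0)"
  have "\<forall>i. \<exists>\<eta>. \<eta> \<longlonglongrightarrow> 0 \<and> (\<forall>\<^sub>F k in sequentially.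
      \<bar>(information *v ?w k) $ i - l (partial_deriv \<mu> i \<theta>\<^sub>0)\<bar> \<le> \<eta> k * (1 + norm (?w k)))"
    using linearized_score by blast
  from choice[OF this] obtain \<eta> where "\<forall>i. \<eta> i \<longlonglongrightarrow> 0 \<and> (\<forall>\<^sub>F k in sequentially.
      \<bar>(information *v ?w k) $ i - l (partial_deriv \<mu> i \<theta>\<^sub>0)\<bar> \<le> \<eta> i k * (1 + norm (?w k)))"
    by (elim exE)
  then have \<eta>: "\<And>i. \<eta> i \<longlonglongrightarrow> 0"
    "\<And>i. \<forall>\<^sub>F k in sequentially. \<bar>(information *v ?w k) $ i - l (partial_deriv \<mu> i \<theta>\<^sub>0)\<bar>
      \<le> \<eta> i k * (1 + norm (?w k))"
    by blast+
  have "(\<lambda>k. \<Sum>i\<in>UNIV. \<eta> i k) \<longlonglongrightarrow> (\<Sum>i\<in>(UNIV::'p set). 0)"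
    by (intro tendsto_sum \<eta>)
  moreover have "\<forall>\<^sub>F k in sequentially. \<forall>i. \<bar>(information *v ?w k) $ i - l (partial_deriv \<mu> i \<theta>\<^sub>0)\<bar>
      \<le> \<eta> i k * (1 + norm (?w k))"
    using \<eta>(2) by (simp add: eventually_all_finite)
  then have "\<forall>\<^sub>F k in sequentially. norm (information *v ?w k - (\<chi> i. l (partial_deriv \<mu> i \<theta>\<^sub>0)))
      \<le> (\<Sum>i\<in>UNIV. \<eta> i k) * (1 + norm (?w k))"
  proof eventually_elim
    case (elim k)
    have "norm (information *v ?w k - (\<chi> i. l (partial_deriv \<mu> i \<theta>\<^sub>0)))
        \<le> (\<Sum>i\<in>UNIV. \<bar>(information *v ?w k - (\<chi> i. l (partial_deriv \<mu> i \<theta>\<^sub>0))) $ i\<bar>)"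
      by (rule norm_le_l1_cart)
    also have "\<dots> \<le> (\<Sum>i\<in>UNIV. \<eta> i k * (1 + norm (?w k)))"
      using elim by (intro sum_mono) simp
    finally show ?case by (simp add: sum_distrib_right)
  qed
  ultimately show ?thesis
    by (intro tendsto_matrix_inv[OF assms, where \<eta> = "\<lambda>k. \<Sum>i\<in>UNIV. \<eta> i k"]) simp_all
qed

end

section \<open>From the essential supremum to a bound at every point\<close>

lemma discrete_kernel_on_cell:
  assumes g: "grid \<tau> n t" and i: "i \<in> {1..n}" and j: "j \<in> {1..n}"
    and s: "s \<in> cell t i" and u: "u \<in> cell t j"
  shows "discrete_kernel K n t (s, u) = K (t i) (t j)"
proof -
  have ind: "indicator (cell t k) v = (if k = m then 1 else 0 :: real)"
    if "k \<in> {1..n}" "m \<in> {1..n}" "v \<in> cell t m" for k m v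
    using disjoint_family_onD[OF disjoint_cell[OF g] that(1,2)] that(3) by (auto simp: indicator_def)
  have "discrete_kernel K n t (s, u)
      = (\<Sum>k=1..n. \<Sum>m=1..n. K (t k) (t m) * ((if k = i then 1 else 0) * (if m = j then 1 else 0)))"
    unfolding discrete_kernel_def
    by (intro sum.cong refl) (simp only: indicator_times fst_conv snd_conv ind[OF _ i s] ind[OF _ j u])
  also have "\<dots> = (\<Sum>k=1..n. \<Sum>m=1..n. if m = j then if k = i then K (t k) (t m) else 0 else 0)"
    by (intro sum.cong refl) simp
  also have "\<dots> = K (t i) (t j)"
    using i j by simp
  finally show ?thesis .
qed

lemma cell_subset_closure:
  assumes g: "grid \<tau> n t" and i: "i \<in> {1..n}"
  shows "cell t i \<subseteq> closure {t (i - 1)<..<t i}"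
proof -
  have "t (i - 1) < t i" "t 0 = 0" using g i by (auto simp: grid_def)
  then show ?thesis by (auto simp: cell_def)
qed

text \<open>An almost everywhere bound on \<open>|K\<^sup>n - K|\<close> holds everywhere: on the interior of a product of cells
  the difference is continuous, so the bound holds at every point there, and it extends to the
  closure, which contains the half-open cells. This is needed since the measures \<open>\<mu> \<theta>\<close> may charge
  Lebesgue null sets.\<close>

lemma oscillation_le_if_Linf_norm_le:
  assumes g: "grid \<tau> n t"
    and cont: "continuous_on ({0..\<tau>} \<times> {0..\<tau>}) (\<lambda>p. K (fst p) (snd p))"
    and le: "Linf_norm ({0..\<tau>} \<times> {0..\<tau>}) (\<lambda>p. discrete_kernel K n t p - K (fst p) (snd p)) \<le> ereal c"
  shows "oscillation_le K t n c"
  unfolding oscillation_le_def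
proof (intro ballI)
  let ?S = "{0..\<tau>} \<times> {0..\<tau>}"
  fix i j s u assume i: "i \<in> {1..n}" and j: "j \<in> {1..n}" and s: "s \<in> cell t i" and u: "u \<in> cell t j"
  define R where "R = {t (i - 1)<..<t i} \<times> {t (j - 1)<..<t j}"
  define C where "C = {p \<in> ?S. \<bar>K (t i) (t j) - K (fst p) (snd p)\<bar> \<le> c}"
  have cont': "continuous_on ?S (\<lambda>p. \<bar>K (t i) (t j) - K (fst p) (snd p)\<bar>)"
    by (intro continuous_on_rabs continuous_on_diff continuous_on_const cont)
  have "C = ?S \<inter> (\<lambda>p. \<bar>K (t i) (t j) - K (fst p) (snd p)\<bar>) -` {..c}"
    by (auto simp: C_def)
  then have "closed C"
    using continuous_closed_preimage[OF cont' closed_Times[OF closed_atLeastAtMost closed_atLeastAtMost]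
        closed_atMost] by simp
  have R: "open R" unfolding R_def by (intro open_Times) auto
  have R_cell: "R \<subseteq> cell t i \<times> cell t j"
    using g by (auto simp: R_def cell_def grid_def split: if_splits)
  have "AE p in restrict_space lborel ?S. ereal \<bar>discrete_kernel K n t p - K (fst p) (snd p)\<bar> \<le> ereal c"
    using esssup_AE
    by (rule eventually_mono) (rule order_trans[OF _ le[unfolded Linf_norm_def]])
  then have "AE p in lborel. p \<in> ?S \<longrightarrow> \<bar>discrete_kernel K n t p - K (fst p) (snd p)\<bar> \<le> c"
    by (subst (asm) AE_restrict_space_iff) (auto simp: borel_closed closed_Times)
  then have "AE p in lborel. p \<in> R \<longrightarrow> p \<in> C"
  proof eventually_elim
    case (elim p)
    show ?case
    proof
      assume "p \<in> R"
      then have p: "fst p \<in> cell t i" "snd p \<in> cell t j" using R_cell by auto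
      then have "p \<in> ?S"
        unfolding mem_Times_iff using cell_subset[OF g i] cell_subset[OF g j] by blast
      moreover have "discrete_kernel K n t p = K (t i) (t j)"
        using discrete_kernel_on_cell[OF g i j p] by simp
      ultimately show "p \<in> C" using elim by (simp add: C_def)
    qed
  qed
  then have AE: "AE p\<in>R in lebesgue. p \<in> C" by (rule AE_completion)
  have "R \<subseteq> C"
    using mem_closed_if_AE_lebesgue_open[OF R \<open>closed C\<close> AE] by blast
  then have "closure R \<subseteq> C" using \<open>closed C\<close> by (rule closure_minimal)
  moreover have "(s, u) \<in> closure R"
    unfolding R_def closure_Times
    using cell_subset_closure[OF g i] cell_subset_closure[OF g j] s u by blast
  ultimately show "\<bar>K (t i) (t j) - K s u\<bar> \<le> c" by (auto simp: C_def)
qed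

text \<open>The norm is an extended real; convergence of the rate makes it finite eventually, so that it may
  be replaced by its real value.\<close>

lemma ereal_rate:
  assumes \<epsilon>: "\<And>k. \<epsilon> k > 0" and lim: "(\<lambda>k. ereal (1 / \<epsilon> k) * L k) \<longlonglongrightarrow> 0"
  shows "(\<lambda>k. real_of_ereal (L k) / \<epsilon> k) \<longlonglongrightarrow> 0"
    and "\<forall>\<^sub>F k in sequentially. L k \<le> ereal (real_of_ereal (L k))"
proof -
  have "(\<lambda>k. real_of_ereal (ereal (1 / \<epsilon> k) * L k)) \<longlonglongrightarrow> 0"
    using lim by (intro lim_real_of_ereal) (simp add: zero_ereal_def)
  then show "(\<lambda>k. real_of_ereal (L k) / \<epsilon> k) \<longlonglongrightarrow> 0"
    by simp
  have "\<forall>\<^sub>F k in sequentially. ereal (1 / \<epsilon> k) * L k < 1"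
    using lim by (rule order_tendstoD) simp
  then show "\<forall>\<^sub>F k in sequentially. L k \<le> ereal (real_of_ereal (L k))"
  proof eventually_elim
    case (elim k)
    have "L k \<noteq> \<infinity>" using elim \<epsilon>[of k] by auto
    then show ?case by (cases "L k") auto
  qed
qed


section \<open>Asymptotics of the maximum contrast estimator\<close>

text \<open>Measurability of the limit is a consequence of the pointwise convergence.\<close>

lemma tendsto_in_probability_pointwise:
  fixes X :: "nat \<Rightarrow> 'w \<Rightarrow> 'b::{metric_space, second_countable_topology}"
  assumes "prob_space P"
    and X: "\<And>k. X k \<in> borel_measurable P"
    and lim: "\<And>\<omega>. \<omega> \<in> space P \<Longrightarrow> (\<lambda>k. X k \<omega>) \<longlonglongrightarrow> Y \<omega>"
  shows "tendsto_in_probability P X Y"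
  unfolding tendsto_in_probability_def
proof (intro allI impI)
  interpret prob_space P by fact
  have Y: "Y \<in> borel_measurable P"
    by (rule borel_measurable_LIMSEQ_metric[OF X lim])
  fix \<delta> :: real assume \<delta>: "\<delta> > 0"
  define A where "A k = {\<omega>\<in>space P. dist (X k \<omega>) (Y \<omega>) > \<delta>}" for k
  have A [measurable]: "A k \<in> sets P" for k
    unfolding A_def using X Y by measurable
  have "(\<lambda>k. expectation (indicator (A k) :: _ \<Rightarrow> real)) \<longlonglongrightarrow> expectation (\<lambda>_. 0)"
  proof (rule integral_dominated_convergence[where w="\<lambda>_. 1"])
    show "AE \<omega> in P. (\<lambda>k. indicator (A k) \<omega> :: real) \<longlonglongrightarrow> 0"
    proof (rule AE_I2)
      fix \<omega> assume "\<omega> \<in> space P"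
      from tendstoD[OF lim[OF this] \<delta>]
      have "\<forall>\<^sub>F k in sequentially. indicator (A k) \<omega> = (0::real)"
        by eventually_elim (simp add: A_def)
      then show "(\<lambda>k. indicator (A k) \<omega> :: real) \<longlonglongrightarrow> 0" by (rule tendsto_eventually)
    qed
  qed (auto simp: indicator_def)
  then show "(\<lambda>k. prob {\<omega>\<in>space P. dist (X k \<omega>) (Y \<omega>) > \<delta>}) \<longlonglongrightarrow> 0"
    by (simp add: A_def[symmetric])
qed

lemma C_diff_2D:
  assumes "C_diff 2 \<Theta> f"
  shows "\<And>x. x \<in> interior \<Theta> \<Longrightarrow> f differentiable (at x)"
    and "continuous_on (interior \<Theta>) (partial_deriv f i)"
proof -
  have *: "\<forall>x\<in>interior \<Theta>. f differentiable (at x)" "extends_continuously \<Theta> (partial_deriv f i)"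
    using assms by (auto simp: numeral_2_eq_2)
  then show "\<And>x. x \<in> interior \<Theta> \<Longrightarrow> f differentiable (at x)" by blast
  obtain g where g: "continuous_on \<Theta> g" "\<And>x. x \<in> interior \<Theta> \<Longrightarrow> g x = partial_deriv f i x"
    using *(2) by (auto simp: extends_continuously_def)
  show "continuous_on (interior \<Theta>) (partial_deriv f i)"
    by (rule continuous_on_eq[OF continuous_on_subset[OF g(1) interior_subset] g(2)])
qed

theorem theorem3p23:
  fixes \<tau> :: real
    and P :: "'w measure" and Z :: "'w \<Rightarrow> real \<Rightarrow> real"
    and \<Theta> :: "(real^'p) set" and \<theta>\<^sub>0 :: "real^'p"
    and \<mu> :: "real^'p \<Rightarrow> real signed_measure"
    and t :: "nat \<Rightarrow> nat \<Rightarrow> real"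
    and \<epsilon> :: "nat \<Rightarrow> real" and N :: "nat \<Rightarrow> nat"
    and \<theta>hat :: "nat \<Rightarrow> real \<Rightarrow> 'w \<Rightarrow> real^'p"
  defines "T \<equiv> {0..\<tau>}"
    and "K \<equiv> cov_fun P Z"
  defines "h\<^sub>0 \<equiv> cov_op T K (\<mu> \<theta>\<^sub>0)"
  defines "X \<equiv> (\<lambda>\<epsilon> \<omega> s. h\<^sub>0 s + \<epsilon> * Z \<omega> s)"
  defines "\<Phi> \<equiv> (\<lambda>n \<epsilon> \<omega>. contrast K \<mu> n (t n) (X \<epsilon> \<omega>))"
    and "d\<mu> \<equiv> (\<lambda>i. partial_deriv \<mu> i \<theta>\<^sub>0)"
  defines "\<Sigma> \<equiv> (\<chi> i j. pairing T (d\<mu> i) (cov_op T K (d\<mu> j))) :: real^'p^'p"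
  assumes "\<tau> > 0"
    and "prob_space P" and "centered_gaussian_vector T P Z"
    and grid: "\<And>n. n \<ge> 1 \<Longrightarrow> grid \<tau> n (t n)"
    and mesh: "(\<lambda>n. mesh n (t n)) \<longlonglongrightarrow> 0"
    and \<Theta>: "compact \<Theta>" "convex \<Theta>" "\<theta>\<^sub>0 \<in> interior \<Theta>"
    and \<mu>: "\<And>\<theta>. \<theta> \<in> \<Theta> \<Longrightarrow> \<mu> \<theta> \<in> signed_measures_on T"
      "continuous_on \<Theta> \<mu>" "C_diff 2 \<Theta> \<mu>"
    and identifiable: "\<And>\<theta>. \<theta> \<in> \<Theta> \<Longrightarrow>
        (\<forall>s\<in>T. cov_op T K (\<mu> \<theta>) s = cov_op T K (\<mu> \<theta>\<^sub>0) s) \<Longrightarrow> \<theta> = \<theta>\<^sub>0"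
    and regular: "invertible \<Sigma>"
    and \<epsilon>: "\<And>k. \<epsilon> k > 0" "\<epsilon> \<longlonglongrightarrow> 0"
    and N: "\<And>k. N k \<ge> 1" "filterlim N at_top sequentially"
    and rate: "(\<lambda>k. ereal (1 / \<epsilon> k) *
        Linf_norm (T \<times> T) (\<lambda>p. discrete_kernel K (N k) (t (N k)) p - K (fst p) (snd p))) \<longlonglongrightarrow> 0"
    and \<theta>hat_measurable: "\<And>k. \<theta>hat (N k) (\<epsilon> k) \<in> borel_measurable P"
    and \<theta>hat_maximizer: "\<And>k \<omega>. \<omega> \<in> space P \<Longrightarrow>
        is_arg_max (\<Phi> (N k) (\<epsilon> k) \<omega>) (\<lambda>\<theta>. \<theta> \<in> \<Theta>) (\<theta>hat (N k) (\<epsilon> k) \<omega>)"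
  shows "tendsto_in_probability P
      (\<lambda>k \<omega>. (1 / \<epsilon> k) *\<^sub>R (\<theta>hat (N k) (\<epsilon> k) \<omega> - \<theta>\<^sub>0))
      (\<lambda>\<omega>. matrix_inv \<Sigma> *v (\<chi> i. pairing T (d\<mu> i) (Z \<omega>)))"
proof -
  interpret G: gaussian_process P \<tau> Z
    using assms by (intro gaussian_process.intro gaussian_process_axioms.intro) (auto simp: T_def)
  interpret C: covariance_kernel \<tau> K
    unfolding K_def
    by unfold_locales (fact G.\<tau> G.cov_fun_cont G.cov_fun_sym G.cov_fun_psd)+
  have mono: "oscillation_le K (t n) n c'" if "oscillation_le K (t n) n c" "c \<le> c'" for n c c'
    using that unfolding oscillation_le_def by (meson order_trans)
  define L where "L k = Linf_norm (T \<times> T)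
    (\<lambda>p. discrete_kernel K (N k) (t (N k)) p - K (fst p) (snd p))" for k
  define r where "r k = \<bar>real_of_ereal (L k)\<bar>" for k
  note L = ereal_rate[OF \<epsilon>(1) rate[folded L_def]]
  have r: "(\<lambda>k. r k / \<epsilon> k) \<longlonglongrightarrow> 0"
  proof -
    have "r k / \<epsilon> k = \<bar>real_of_ereal (L k) / \<epsilon> k\<bar>" for k
      using \<epsilon>(1)[of k] by (simp add: r_def)
    then show ?thesis using tendsto_rabs_zero[OF L(1)] by simp
  qed
  have osc: "\<forall>\<^sub>F k in sequentially. oscillation_le K (t (N k)) (N k) (r k)"
    using L(2)
  proof eventually_elim
    case (elim k)
    have "oscillation_le K (t (N k)) (N k) (real_of_ereal (L k))"
      by (rule oscillation_le_if_Linf_norm_le[OF grid[OF N(1)] C.cont])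
        (use elim in \<open>simp add: L_def T_def\<close>)
    then show ?case by (rule mono) (unfold r_def, rule abs_ge_self)
  qed
  have r_nonneg: "0 \<le> r k" for k
    unfolding r_def by (rule abs_ge_zero)
  \<comment> \<open>\<open>c\<close> covers the error of the double sum and that of the quadrature of \<open>h\<^sub>0\<close> alike\<close>
  define c where "c = 1 + 2 * norm (\<mu> \<theta>\<^sub>0)"
  \<comment> \<open>convergence along every single path; randomness plays no further part\<close>
  have path: "(\<lambda>k. (1 / \<epsilon> k) *\<^sub>R (\<theta>hat (N k) (\<epsilon> k) \<omega> - \<theta>\<^sub>0))
      \<longlonglongrightarrow> matrix_inv \<Sigma> *v (\<chi> i. pairing T (d\<mu> i) (Z \<omega>))" if \<omega>: "\<omega> \<in> space P" for \<omega>
  proof -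
    note Z = G.cont_path[OF \<omega>]
    obtain s where s: "s \<longlonglongrightarrow> 0"
      "\<And>n \<nu>. \<bar>quadrature (t n) n \<nu> (Z \<omega>) - pairing {0..\<tau>} \<nu> (Z \<omega>)\<bar> \<le> s n * norm \<nu>"
      using quadrature_uniform_seq[OF grid mesh \<open>\<tau> > 0\<close> Z] by blast
    interpret PC: perturbed_contrast \<Theta> \<theta>\<^sub>0 \<mu> C.energy "\<lambda>\<nu>. pairing {0..\<tau>} \<nu> (Z \<omega>)"
      "\<lambda>k \<nu>. quadrature (t (N k)) (N k) \<nu> h\<^sub>0" "\<lambda>k. quadrature2 (t (N k)) (N k) K"
      "\<lambda>k \<nu>. quadrature (t (N k)) (N k) \<nu> (Z \<omega>)" \<epsilon> "\<lambda>k. r k * c" "\<lambda>k. s (N k)"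
      "\<lambda>k. \<theta>hat (N k) (\<epsilon> k) \<omega>"
    proof (rule perturbed_contrast.intro)
      show "\<theta> = \<theta>\<^sub>0" if "\<theta> \<in> \<Theta>" "C.energy (\<mu> \<theta> - \<mu> \<theta>\<^sub>0) (\<mu> \<theta> - \<mu> \<theta>\<^sub>0) = 0" for \<theta>
        using identifiable[OF that(1)] C.cov_op_eq_0_if_energy_eq_0[OF that(2)] C.cov_op_diff
        by (simp add: T_def)
      show "\<forall>\<^sub>F k in sequentially. \<forall>\<nu>.
          \<bar>quadrature (t (N k)) (N k) \<nu> h\<^sub>0 - C.energy \<nu> (\<mu> \<theta>\<^sub>0)\<bar> \<le> r k * c * norm \<nu>"
        using osc
      proof eventually_elim
        case (elim k)
        show ?case
        proof
          fix \<nu> :: "real signed_measure"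
          have "2 * r k * norm \<nu> * norm (\<mu> \<theta>\<^sub>0) = r k * norm \<nu> * (2 * norm (\<mu> \<theta>\<^sub>0))" by simp
          also have "\<dots> \<le> r k * norm \<nu> * c"
            by (intro mult_left_mono mult_nonneg_nonneg r_nonneg) (simp_all add: c_def)
          finally show "\<bar>quadrature (t (N k)) (N k) \<nu> h\<^sub>0 - C.energy \<nu> (\<mu> \<theta>\<^sub>0)\<bar> \<le> r k * c * norm \<nu>"
            using C.quadrature_cov_op_error[OF grid[OF N(1)] N(1) elim, of \<nu> "\<mu> \<theta>\<^sub>0"]
            by (simp add: h\<^sub>0_def T_def mult.commute mult.left_commute)
        qed
      qed
      show "\<forall>\<^sub>F k in sequentially. \<forall>\<nu> \<rho>.
          \<bar>quadrature2 (t (N k)) (N k) K \<nu> \<rho> - C.energy \<nu> \<rho>\<bar> \<le> r k * c * norm \<nu> * norm \<rho>"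
        using osc
      proof eventually_elim
        case (elim k)
        have "r k * 1 \<le> r k * c" by (intro mult_left_mono r_nonneg) (simp add: c_def)
        then have "r k * norm \<nu> * norm \<rho> \<le> r k * c * norm \<nu> * norm \<rho>" for \<nu> \<rho> :: "real signed_measure"
          by (intro mult_right_mono) auto
        then show ?case
          using C.quadrature2_error[OF grid[OF N(1)] N(1) elim] order_trans by blast
      qed
      have "(\<lambda>k. r k / \<epsilon> k * c) \<longlonglongrightarrow> 0 * c"
        by (intro tendsto_intros r)
      then show "(\<lambda>k. r k * c / \<epsilon> k) \<longlonglongrightarrow> 0" by simp
      show "(\<lambda>k. s (N k)) \<longlonglongrightarrow> 0"
        by (rule filterlim_compose[OF s(1) N(2)])
      have "\<Phi> (N k) (\<epsilon> k) \<omega> = (\<lambda>\<theta>. quadrature (t (N k)) (N k) (\<mu> \<theta>) h\<^sub>0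
          + \<epsilon> k * quadrature (t (N k)) (N k) (\<mu> \<theta>) (Z \<omega>)
          - quadrature2 (t (N k)) (N k) K (\<mu> \<theta>) (\<mu> \<theta>) / 2)" for k
        by (rule ext) (simp add: \<Phi>_def X_def contrast_eq quadrature_def distrib_left sum.distrib
            sum_distrib_left mult.left_commute)
      then show "is_arg_max (\<lambda>\<theta>. quadrature (t (N k)) (N k) (\<mu> \<theta>) h\<^sub>0
          + \<epsilon> k * quadrature (t (N k)) (N k) (\<mu> \<theta>) (Z \<omega>)
          - quadrature2 (t (N k)) (N k) K (\<mu> \<theta>) (\<mu> \<theta>) / 2) (\<lambda>\<theta>. \<theta> \<in> \<Theta>) (\<theta>hat (N k) (\<epsilon> k) \<omega>)" for k
        using \<theta>hat_maximizer[OF \<omega>, of k] by simp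
      show "bounded_linear (\<lambda>\<nu>. pairing {0..\<tau>} \<nu> (Z \<omega>))"
        by (rule bounded_linear_pairing[OF \<open>\<tau> > 0\<close> Z])
      show "\<forall>\<^sub>F k in sequentially. \<forall>\<nu>. \<bar>quadrature (t (N k)) (N k) \<nu> (Z \<omega>) - pairing {0..\<tau>} \<nu> (Z \<omega>)\<bar>
          \<le> s (N k) * norm \<nu>"
        using s(2) by simp
    qed (fact \<Theta> \<mu> C_diff_2D[OF \<mu>(3)] C.bounded_bilinear_energy C.energy_sym C.energy_nonneg
        bounded_linear_quadrature bounded_bilinear_quadrature2 C.quadrature2_sym \<epsilon>)+
    have "PC.information = \<Sigma>"
      by (simp add: PC.information_def \<Sigma>_def d\<mu>_def T_def)
    with PC.maximizer_expansion regular show ?thesis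
      by (simp add: d\<mu>_def T_def)
  qed
  show ?thesis
    by (rule tendsto_in_probability_pointwise[OF \<open>prob_space P\<close> _ path])
      (intro borel_measurable_scaleR borel_measurable_diff borel_measurable_const \<theta>hat_measurable)
qed

end
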